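(* Let $U(t,t_0)$ ($t,t_0>0$) be the classical evolution of the free massless scalar field on $\mathcal P$, i.e. the block diagonal map acting by $b_{m}\mapsto e^{-im(t-t_0)}b_{m}$ and $b_{-m}\mapsto e^{-im(t-t_0)}b_{-m}$ for all $m\in\mathbb N$ (with the conjugate action on $b_{m}^*$, $b_{-m}^*$). Let $J$ be any compatible complex structure on $\mathcal P$ that is invariant under all $S^1$-translations, i.e. $T_\alpha^{-1}JT_\alpha=J$ for all $\alpha\in S^1$. If $U(t,t_0)$ is unitarily implementable with respect to $J$ for all $t,t_0>0$, then the Fock representation defined by $J$ is unitarily equivalent to the one defined by $J_0$.
   Context: Phase space (zero mode removed). $\mathcal P$ is the real vector space of pairs $(\xi,P)$ of smooth real functions on $S^1=\mathbb R/2\pi\mathbb Z$ with zero mean, with symplectic form $\Omega((\xi_1,P_1),(\xi_2,P_2))=\oint(\xi_2P_1-\xi_1P_2)\,d\theta$. Write $\xi=\sum_{n\ne0}\xi_n e^{in\theta}/\sqrt{2\pi}$, $P=\sum_{n\neq 0} P^n e^{in\theta}/\sqrt{2\pi}$ and, for $m\in\mathbb N=\{1,2,\dots\}$, $b_m=(m\xi_m+iP^m)/\sqrt{2m}$, $b_{-m}^*=(m\xi_m-iP^m)/\sqrt{2m}$ ($*$ is complex conjugation; $b_m^*$, $b_{-m}$ are the conjugates). Put $B_m=(b_m,b_{-m}^*,b_{-m},b_m^* )^T$. A real-linear map $A$ of $\mathcal P$ is block diagonal with $4\times4$ blocks $A_m$ if it acts by $B_m\mapsto A_mB_m$ for all $m$.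 The evolution in the claim is that of $\dot\xi=P$, $\dot P=\xi''$. Translations: $T_\alpha$ acts by $b_m\mapsto e^{im\alpha}b_m$, $b_{-m}^*\mapsto e^{im\alpha}b_{-m}^*$, $b_{-m}\mapsto e^{-im\alpha}b_{-m}$, $b_m^*\mapsto e^{-im\alpha}b_m^*$. Complex structures: a compatible complex structure is a real-linear map $J:\mathcal P\to\mathcal P$ with $J^2=-\mathbf 1$, which is symplectic and such that $\Omega(J\cdot,\cdot)$ is positive definite. It gives the inner product $\langle\cdot,\cdot\rangle_J=\{\Omega(J\cdot,\cdot)-i\Omega(\cdot,\cdot)\}/2$; the completion of $\mathcal P$ is the one-particle Hilbert space of the Fock representation defined by $J$. A real-linear map of $\mathcal P$ is Hilbert-Schmidt with respect to $\langle\cdot,\cdot\rangle_J$ if it extends to a Hilbert-Schmidt (real-linear) operator on this completion. The reference structure $J_0$ is block diagonal with $(J_0)_m=\mathrm{diag}(i,-i,i,-i)$. Unitarity criteria (standard, taken as definitions): a symplectic transformation $A$ is unitarily implementable with respect to $J$ iff its antilinear part $(A+JAJ)/2$ is Hilbert-Schmidt with respect to $\langle\cdot,\cdot\rangle_J$; the Fock representations defined by $J$ and $J_0$ are unitarily equivalent iff $J-J_0$ is Hilbert-Schmidt with respect to $\langle\cdot,\cdot\rangle_{J_0}$. *)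

theory Defs
  imports "HOL-Analysis.Analysis"
begin

section \<open>Phase space\<close>

definition smooth :: "(real \<Rightarrow> real) \<Rightarrow> bool" where
  "smooth f \<longleftrightarrow> (\<forall>k x. ((deriv ^^ k) f) differentiable (at x))"

lemma smooth_differentiable: "smooth f \<Longrightarrow> f differentiable (at x)"
  unfolding smooth_def by (metis funpow_0)

lemma smooth_continuous_on: "smooth f \<Longrightarrow> continuous_on S f"
  by (meson continuous_at_imp_continuous_on differentiable_imp_continuous_within
      smooth_differentiable)

lemma smooth_integrable: "smooth f \<Longrightarrow> f integrable_on {a..b}"
  by (simp add: integrable_continuous_real smooth_continuous_on)

lemma smooth_funpow_field_differentiable:
  "smooth f \<Longrightarrow> ((deriv ^^ k) f) field_differentiable (at x)"
  unfolding smooth_def field_differentiable_def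
  by (metis real_differentiableE)

lemma smooth_zero: "smooth (\<lambda>_. 0)"
proof -
  have "(deriv ^^ k) (\<lambda>_. 0::real) = (\<lambda>_. 0)" for k
    by (induction k) auto
  then show ?thesis
    by (simp add: smooth_def)
qed

lemma smooth_add:
  assumes "smooth f" "smooth g"
  shows "smooth (\<lambda>x. f x + g x)"
proof -
  have "(deriv ^^ k) (\<lambda>x. f x + g x) = (\<lambda>x. (deriv ^^ k) f x + (deriv ^^ k) g x)" for k
    by (induction k)
      (auto simp: deriv_add smooth_funpow_field_differentiable[OF assms(1)]
        smooth_funpow_field_differentiable[OF assms(2)])
  then show ?thesis
    using assms by (auto simp: smooth_def intro!: differentiable_add)
qed

lemma smooth_cmult:
  assumes "smooth f"
  shows "smooth (\<lambda>x. c * f x)"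
proof -
  have "(deriv ^^ k) (\<lambda>x. c * f x) = (\<lambda>x. c * (deriv ^^ k) f x)" for k
    by (induction k)
      (auto simp: deriv_cmult smooth_funpow_field_differentiable[OF assms])
  then show ?thesis
    using assms by (auto simp: smooth_def intro!: differentiable_mult)
qed

text \<open>Functions on the circle are represented by their \<open>2\<pi>\<close>-periodic lifts to the real line.\<close>

typedef circle_fun =
  "{f :: real \<Rightarrow> real. smooth f \<and> (\<forall>x. f (x + 2 * pi) = f x) \<and> integral {0..2 * pi} f = 0}"
  morphisms app_circle Abs_circle_fun
  by (rule exI[of _ "\<lambda>_. 0"]) (simp add: smooth_zero)

setup_lifting type_definition_circle_fun

instantiation circle_fun :: real_vector
begin

lift_definition zero_circle_fun :: circle_fun is "\<lambda>_. 0"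
  by (simp add: smooth_zero)

lift_definition plus_circle_fun :: "circle_fun \<Rightarrow> circle_fun \<Rightarrow> circle_fun"
  is "\<lambda>f g x. f x + g x"
  by (simp add: smooth_add Henstock_Kurzweil_Integration.integral_add smooth_integrable)

lift_definition scaleR_circle_fun :: "real \<Rightarrow> circle_fun \<Rightarrow> circle_fun"
  is "\<lambda>c f x. c * f x"
  by (simp add: smooth_cmult)

definition uminus_circle_fun :: "circle_fun \<Rightarrow> circle_fun" where
  "uminus_circle_fun f = (-1) *\<^sub>R f"

definition minus_circle_fun :: "circle_fun \<Rightarrow> circle_fun \<Rightarrow> circle_fun" where
  "minus_circle_fun f g = f + (- g)"

instance
  by standard
    (unfold uminus_circle_fun_def minus_circle_fun_def,
      (transfer, auto simp: algebra_simps)+)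

end

type_synonym phase = "circle_fun \<times> circle_fun"

definition Omega :: "phase \<Rightarrow> phase \<Rightarrow> real" where
  "Omega x y = integral {0..2 * pi}
     (\<lambda>\<theta>. app_circle (fst y) \<theta> * app_circle (snd x) \<theta>
         - app_circle (fst x) \<theta> * app_circle (snd y) \<theta>)"

text \<open>The coefficients \<open>f\<^sub>n\<close> of the expansion \<open>f = (\<Sum>n. f\<^sub>n e\<^sup>i\<^sup>n\<^sup>\<theta>) / sqrt (2 \<pi>)\<close>.\<close>

definition fourier_coeff :: "circle_fun \<Rightarrow> int \<Rightarrow> complex" where
  "fourier_coeff f n =
     integral {0..2 * pi} (\<lambda>\<theta>. of_real (app_circle f \<theta>) * cis (- (of_int n * \<theta>)))
       / of_real (sqrt (2 * pi))"

text \<open>For \<open>m \<ge> 1\<close>, these are \<open>b\<^sub>m\<close> and \<open>b\<^sub>-\<^sub>m\<^sup>*\<close>.\<close>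

definition b_pos :: "nat \<Rightarrow> phase \<Rightarrow> complex" where
  "b_pos m x = (of_nat m * fourier_coeff (fst x) (int m) + \<i> * fourier_coeff (snd x) (int m))
     / of_real (sqrt (2 * real m))"

definition b_neg_star :: "nat \<Rightarrow> phase \<Rightarrow> complex" where
  "b_neg_star m x =
     (of_nat m * fourier_coeff (fst x) (int m) - \<i> * fourier_coeff (snd x) (int m))
     / of_real (sqrt (2 * real m))"

definition B :: "nat \<Rightarrow> phase \<Rightarrow> complex ^ 4" where
  "B m x = vector [b_pos m x, b_neg_star m x, cnj (b_neg_star m x), cnj (b_pos m x)]"

text \<open>A map is determined by its blocks, since a zero-mean smooth function is determined by
  its Fourier coefficients with positive index (reality gives the others).\<close>

definition block_diagonal :: "(phase \<Rightarrow> phase) \<Rightarrow> (nat \<Rightarrow> complex ^ 4 ^ 4) \<Rightarrow> bool" where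
  "block_diagonal A M \<longleftrightarrow> linear A \<and> (\<forall>m\<ge>1. \<forall>x. B m (A x) = M m *v B m x)"

definition diag4 :: "complex \<Rightarrow> complex \<Rightarrow> complex \<Rightarrow> complex \<Rightarrow> complex ^ 4 ^ 4" where
  "diag4 a b c d = (\<chi> i j. if i = j then (vector [a, b, c, d] :: complex ^ 4) $ i else 0)"

definition translation_block :: "real \<Rightarrow> nat \<Rightarrow> complex ^ 4 ^ 4" where
  "translation_block \<alpha> m =
     diag4 (cis (real m * \<alpha>)) (cis (real m * \<alpha>)) (cis (- (real m * \<alpha>))) (cis (- (real m * \<alpha>)))"

definition evolution_block :: "real \<Rightarrow> real \<Rightarrow> nat \<Rightarrow> complex ^ 4 ^ 4" where
  "evolution_block t t0 m =
     (let z = cis (- (real m * (t - t0))) in diag4 z (cnj z) z (cnj z))"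

definition reference_block :: "nat \<Rightarrow> complex ^ 4 ^ 4" where
  "reference_block m = diag4 \<i> (- \<i>) \<i> (- \<i>)"


section \<open>Complex structures and Fock representations\<close>

definition symplectic :: "(phase \<Rightarrow> phase) \<Rightarrow> bool" where
  "symplectic A \<longleftrightarrow> linear A \<and> bij A \<and> (\<forall>x y. Omega (A x) (A y) = Omega x y)"

definition compatible_complex_structure :: "(phase \<Rightarrow> phase) \<Rightarrow> bool" where
  "compatible_complex_structure J \<longleftrightarrow>
     linear J \<and> (\<forall>x. J (J x) = - x) \<and> symplectic J \<and> (\<forall>x. x \<noteq> 0 \<longrightarrow> Omega (J x) x > 0)"

definition inner_J :: "(phase \<Rightarrow> phase) \<Rightarrow> phase \<Rightarrow> phase \<Rightarrow> complex" where
  "inner_J J x y = (of_real (Omega (J x) y) - \<i> * of_real (Omega x y)) / 2"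

text \<open>The completion of phase space with respect to \<open>inner_J J\<close>, given as an isometric linear
  map \<open>\<iota>\<close> with dense range into a Hilbert space; it is unique up to isomorphism.  Only real-linear
  operators on the completion are considered, so the completion is viewed as a real Hilbert
  space, whose inner product is the real part of the complex one (the norm is the same).\<close>

definition is_completion ::
  "(phase \<Rightarrow> phase) \<Rightarrow> (phase \<Rightarrow> 'h :: {real_inner, complete_space}) \<Rightarrow> bool" where
  "is_completion J \<iota> \<longleftrightarrow>
     linear \<iota> \<and> (\<forall>x y. \<iota> x \<bullet> \<iota> y = Re (inner_J J x y)) \<and> closure (range \<iota>) = UNIV"

definition orthonormal_basis :: "'h :: real_inner set \<Rightarrow> bool" where
  "orthonormal_basis E \<longleftrightarrow>
     pairwise orthogonal E \<and> (\<forall>e\<in>E. norm e = 1) \<and> closure (span E) = UNIV"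

definition hilbert_schmidt :: "('h :: {real_inner, complete_space} \<Rightarrow> 'h) \<Rightarrow> bool" where
  "hilbert_schmidt S \<longleftrightarrow>
     bounded_linear S \<and> (\<exists>E. orthonormal_basis E \<and> (\<lambda>e. (norm (S e))\<^sup>2) summable_on E)"

definition hilbert_schmidt_wrt ::
  "(phase \<Rightarrow> 'h :: {real_inner, complete_space}) \<Rightarrow> (phase \<Rightarrow> phase) \<Rightarrow> bool" where
  "hilbert_schmidt_wrt \<iota> A \<longleftrightarrow> (\<exists>S. hilbert_schmidt S \<and> (\<forall>x. S (\<iota> x) = \<iota> (A x)))"

definition antilinear_part :: "(phase \<Rightarrow> phase) \<Rightarrow> (phase \<Rightarrow> phase) \<Rightarrow> phase \<Rightarrow> phase" where
  "antilinear_part J A x = (1 / 2) *\<^sub>R (A x + J (A (J x)))"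

text \<open>In the next two definitions \<open>\<iota>\<close> and \<open>\<iota>0\<close> are completions for \<open>J\<close> and \<open>J0\<close>.\<close>

definition unitarily_implementable ::
  "(phase \<Rightarrow> 'h :: {real_inner, complete_space}) \<Rightarrow> (phase \<Rightarrow> phase) \<Rightarrow> (phase \<Rightarrow> phase) \<Rightarrow> bool"
  where "unitarily_implementable \<iota> J A \<longleftrightarrow> hilbert_schmidt_wrt \<iota> (antilinear_part J A)"

definition fock_equivalent ::
  "(phase \<Rightarrow> 'h :: {real_inner, complete_space}) \<Rightarrow> (phase \<Rightarrow> phase) \<Rightarrow> (phase \<Rightarrow> phase) \<Rightarrow> bool"
  where "fock_equivalent \<iota>0 J J0 \<longleftrightarrow> hilbert_schmidt_wrt \<iota>0 (\<lambda>x. J x - J0 x)"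

end

theory Submission
  imports Defs
begin

text \<open>Translation invariance and symplecticity force \<open>J\<close> to act on \<open>(b\<^sub>m, b\<^sub>-\<^sub>m\<^sup>*)\<close> by a matrix with
  rows \<open>(i c, q)\<close> and \<open>(q\<^sup>*, - i c)\<close>, where \<open>c > 0\<close> and \<open>c\<^sup>2 = 1 + |q|\<^sup>2\<close>.  On that mode the
  antilinear part of the evolution by time \<open>\<tau>\<close> scales the \<open>J\<close>-norm of \<open>(1, 0)\<close> by
  \<open>|sin (m \<tau>)| |q|\<close>, so implementability makes \<open>\<Sum>m. sin\<^sup>2 (m \<tau>) |q\<^sub>m|\<^sup>2\<close> finite for every \<open>\<tau>\<close>.
  By Baire's theorem this sum is bounded uniformly on some interval, and integrating over the
  interval gives \<open>\<Sum>m. |q\<^sub>m|\<^sup>2 < \<infinity>\<close>.  The block of \<open>J - J\<^sub>0\<close> has norm \<open>O(|q\<^sub>m|)\<close>, hence the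
  direct sum of the blocks is Hilbert-Schmidt; it extends \<open>J - J\<^sub>0\<close> since the modes are total.\<close>

section \<open>Hilbert-Schmidt operators\<close>

text \<open>Implementability is a statement in the \<open>J\<close>-norm and equivalence one in the
  \<open>J0\<close>-norm, and the two are not comparable beforehand since nothing bounds the numbers
  c. The bridge is the entry q: for a test vector normalized in the \<open>J\<close>-norm the weight
  is free of c, and the \<open>J0\<close>-norm of the block of the difference is controlled through
  c - 1 <= |q|. Two features of the definitions shape the rest. Hilbert-Schmidt is witnessed by some
  unknown orthonormal basis, so sums over modes must be compared with sums over that basis. No
  continuity of \<open>J\<close> is given, so \<open>J x\<close> cannot be found by applying
  \<open>J\<close> to a mode expansion of \<open>x\<close>; its coefficients come from moving
  \<open>J\<close> across \<open>Omega\<close>. Baire enters because finiteness at each time comes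
  with no bound uniform in time.\<close>

lemma orthonormal_projection:
  fixes C :: "'h::real_inner set"
  assumes "finite C" "pairwise orthogonal C"
  shows sum_inner_sgn_le: "(\<Sum>g\<in>C. (w \<bullet> sgn g)\<^sup>2) \<le> (norm w)\<^sup>2"
    and norm_eq_sum_inner_sgn: "w \<in> span C \<Longrightarrow> (norm w)\<^sup>2 = (\<Sum>g\<in>C. (w \<bullet> sgn g)\<^sup>2)"
proof -
  \<comment> \<open>\<open>p\<close> is the orthogonal projection of \<open>w\<close> to
    \<open>span C\<close>. Since \<open>sgn\<close> normalizes and fixes 0, the set \<open>C\<close>
    may contain 0, which orthogonalizing a dependent family can produce.\<close>
  define p where "p = (\<Sum>g\<in>C. (w \<bullet> sgn g) *\<^sub>R sgn g)"
  have p_inner: "p \<bullet> sgn g = w \<bullet> sgn g" if "g \<in> C" for g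
  proof -
    have "p \<bullet> sgn g = (\<Sum>g'\<in>C. if g' = g then w \<bullet> sgn g else 0)"
      unfolding p_def inner_sum_left
    proof (rule sum.cong[OF refl])
      fix g' assume "g' \<in> C"
      then have "g' \<noteq> g \<Longrightarrow> g' \<bullet> g = 0"
        using assms(2) that by (auto simp: pairwise_def orthogonal_def)
      moreover have "g \<noteq> 0 \<Longrightarrow> sgn g \<bullet> sgn g = 1"
        by (simp add: power2_norm_eq_inner[symmetric] norm_sgn)
      ultimately show "((w \<bullet> sgn g') *\<^sub>R sgn g') \<bullet> sgn g = (if g' = g then w \<bullet> sgn g else 0)"
        by (cases "g = 0") (auto simp: sgn_div_norm)
    qed
    then show ?thesis
      using assms(1) that by simp
  qed
  have pw: "p \<bullet> w = (\<Sum>g\<in>C. (w \<bullet> sgn g)\<^sup>2)"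
    by (simp add: p_def inner_sum_left inner_commute[of w] power2_eq_square)
  have pp: "p \<bullet> p = (\<Sum>g\<in>C. (w \<bullet> sgn g)\<^sup>2)"
    by (subst (2) p_def) (simp add: inner_sum_right p_inner power2_eq_square)
  have "0 \<le> (w - p) \<bullet> (w - p)"
    by simp
  also have "\<dots> = (norm w)\<^sup>2 - (\<Sum>g\<in>C. (w \<bullet> sgn g)\<^sup>2)"
    by (simp add: inner_diff inner_commute[of w p] pw pp power2_norm_eq_inner)
  finally show "(\<Sum>g\<in>C. (w \<bullet> sgn g)\<^sup>2) \<le> (norm w)\<^sup>2"
    by simp
  show "(norm w)\<^sup>2 = (\<Sum>g\<in>C. (w \<bullet> sgn g)\<^sup>2)" if "w \<in> span C"
  proof -
    have "orthogonal (w - p) g" if "g \<in> C" for g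
      using p_inner[OF that]
      by (cases "g = 0") (auto simp: orthogonal_def sgn_div_norm inner_diff_left)
    moreover have "p \<in> span C"
      unfolding p_def sgn_div_norm by (intro span_sum span_mul span_base)
    then have "w - p \<in> span C"
      using that by (simp add: span_diff)
    ultimately have "orthogonal (w - p) (w - p)"
      using orthogonal_to_span by blast
    then have "w = p"
      by (simp add: orthogonal_def)
    then show ?thesis
      using pp by (simp add: power2_norm_eq_inner)
  qed
qed

text \<open>Cauchy-Schwarz settles finite combinations of basis vectors; the inequality is a closed
  condition on \<open>v\<close>, so density of \<open>span E\<close> does the rest.\<close>

lemma functional_le_orthonormal_basis:
  fixes \<phi> :: "'h::real_inner \<Rightarrow> real"
  assumes E: "orthonormal_basis E" and \<phi>: "bounded_linear \<phi>"
    and C: "\<And>F. finite F \<Longrightarrow> F \<subseteq> E \<Longrightarrow> (\<Sum>e\<in>F. (\<phi> e)\<^sup>2) \<le> C"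
  shows "(\<phi> v)\<^sup>2 \<le> (norm v)\<^sup>2 * C"
proof -
  have "(\<phi> v)\<^sup>2 \<le> (norm v)\<^sup>2 * C" if v: "v \<in> span E" for v
  proof -
    obtain F u where F: "finite F" "F \<subseteq> E" and v: "v = (\<Sum>e\<in>F. u e *\<^sub>R e)"
      using v unfolding span_explicit by blast
    have norm_v: "(norm v)\<^sup>2 = (\<Sum>e\<in>F. (u e)\<^sup>2)"
    proof -
      have "(norm v)\<^sup>2 = (\<Sum>e\<in>F. (norm (u e *\<^sub>R e))\<^sup>2)"
        unfolding v by (rule norm_sum_Pythagorean[OF F(1)])
          (use E F(2) in \<open>auto simp: orthonormal_basis_def pairwise_def orthogonal_def subset_iff\<close>)
      also have "\<dots> = (\<Sum>e\<in>F. (u e)\<^sup>2)"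
        using E F(2) by (intro sum.cong refl) (auto simp: orthonormal_basis_def)
      finally show ?thesis .
    qed
    have "(\<phi> v)\<^sup>2 = (\<Sum>e\<in>F. u e * \<phi> e)\<^sup>2"
      unfolding v using bounded_linear.linear[OF \<phi>] by (simp add: linear_sum linear_scale)
    also have "\<dots> \<le> (\<Sum>e\<in>F. (u e)\<^sup>2) * (\<Sum>e\<in>F. (\<phi> e)\<^sup>2)"
      by (rule Cauchy_Schwarz_ineq_sum)
    also have "\<dots> \<le> (norm v)\<^sup>2 * C"
      unfolding norm_v by (intro mult_left_mono C F sum_nonneg) auto
    finally show ?thesis .
  qed
  then have "span E \<subseteq> {v. (\<phi> v)\<^sup>2 \<le> (norm v)\<^sup>2 * C}"
    by blast
  moreover have "closed {v. (\<phi> v)\<^sup>2 \<le> (norm v)\<^sup>2 * C}"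
    by (intro closed_Collect_le continuous_intros linear_continuous_on \<phi>)
  ultimately have "closure (span E) \<subseteq> {v. (\<phi> v)\<^sup>2 \<le> (norm v)\<^sup>2 * C}"
    by (rule closure_minimal)
  then show ?thesis
    using E by (auto simp: orthonormal_basis_def)
qed

text \<open>Evaluating \<open>\<phi>\<close> at \<open>\<Sum>i. \<phi> (f i) f i\<close> gives Bessel's inequality for the functional \<open>\<phi>\<close>
  without representing it by a vector, so no adjoint of \<open>S\<close> is needed below.\<close>

lemma functional_sum_le_orthonormal_basis:
  fixes \<phi> :: "'h::real_inner \<Rightarrow> real" and f :: "'i \<Rightarrow> 'h"
  assumes E: "orthonormal_basis E" and \<phi>: "bounded_linear \<phi>"
    and C: "\<And>F. finite F \<Longrightarrow> F \<subseteq> E \<Longrightarrow> (\<Sum>e\<in>F. (\<phi> e)\<^sup>2) \<le> C"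
    and I: "finite I" "pairwise (\<lambda>i j. orthogonal (f i) (f j)) I" "\<And>i. i \<in> I \<Longrightarrow> norm (f i) = 1"
  shows "(\<Sum>i\<in>I. (\<phi> (f i))\<^sup>2) \<le> C"
proof -
  define v where "v = (\<Sum>i\<in>I. \<phi> (f i) *\<^sub>R f i)"
  define s where "s = (\<Sum>i\<in>I. (\<phi> (f i))\<^sup>2)"
  have "(norm v)\<^sup>2 = (\<Sum>i\<in>I. (norm (\<phi> (f i) *\<^sub>R f i))\<^sup>2)"
    unfolding v_def using I(2)
    by (intro norm_sum_Pythagorean I(1)) (auto simp: pairwise_def orthogonal_def)
  then have norm_v: "(norm v)\<^sup>2 = s"
    using I(3) by (simp add: s_def)
  have "\<phi> v = s"
    unfolding v_def s_def using bounded_linear.linear[OF \<phi>]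
    by (simp add: linear_sum linear_scale power2_eq_square)
  then have "s\<^sup>2 \<le> s * C"
    using functional_le_orthonormal_basis[OF E \<phi> C, of v] norm_v by simp
  moreover have "s \<ge> 0"
    unfolding s_def by (simp add: sum_nonneg)
  moreover have "C \<ge> 0"
    using C[of "{}"] by simp
  ultimately show ?thesis
    unfolding s_def[symmetric] by (cases "s = 0") (auto simp: power2_eq_square)
qed

lemma has_sum_sum:
  fixes f :: "'i \<Rightarrow> 'a \<Rightarrow> real"
  assumes "\<And>i. i \<in> I \<Longrightarrow> (f i has_sum s i) A"
  shows "((\<lambda>x. \<Sum>i\<in>I. f i x) has_sum (\<Sum>i\<in>I. s i)) A"
  using assms
  by (induction I rule: infinite_finite_induct) (auto intro!: has_sum_add)

text \<open>Coordinatewise, \<open>S v \<bullet> sgn g\<close> is a bounded functional of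
  \<open>v\<close>, to which the preceding Bessel inequality applies. Summing over \<open>g\<close>
  gives back the norms, exactly for the vectors \<open>S (f i)\<close> and as an upper bound for the
  \<open>S e\<close>.\<close>

lemma hilbert_schmidt_norm_basis_independent:
  fixes S :: "'h::real_inner \<Rightarrow> 'h" and f :: "'i \<Rightarrow> 'h"
  assumes E: "orthonormal_basis E" and S: "bounded_linear S"
    and HS: "(\<lambda>e. (norm (S e))\<^sup>2) summable_on E"
    and I: "finite I" "pairwise (\<lambda>i j. orthogonal (f i) (f j)) I" "\<And>i. i \<in> I \<Longrightarrow> norm (f i) = 1"
  shows "(\<Sum>i\<in>I. (norm (S (f i)))\<^sup>2) \<le> infsum (\<lambda>e. (norm (S e))\<^sup>2) E"
proof -
  define K where "K = infsum (\<lambda>e. (norm (S e))\<^sup>2) E"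
  \<comment> \<open>The finitely many vectors \<open>S (f i)\<close> lie in the span of a finite
    orthogonal set, which makes their norms finite sums that can be swapped with the sum over
    \<open>I\<close>.\<close>
  obtain G where G: "finite G" "span G = span ((S \<circ> f) ` I)" "pairwise orthogonal G"
    using basis_orthogonal[of "(S \<circ> f) ` I"] I(1) by auto
  have lin: "bounded_linear (\<lambda>v. S v \<bullet> g)" for g
    using bounded_linear_compose[OF bounded_linear_inner_left S] .
  have sums: "(\<lambda>e. (S e \<bullet> sgn g)\<^sup>2) summable_on E" for g
  proof (rule summable_on_comparison_test[OF HS])
    show "(S e \<bullet> sgn g)\<^sup>2 \<le> (norm (S e))\<^sup>2" for e
      using sum_inner_sgn_le[of "{g}" "S e"] by simp
  qed auto
  have "(\<Sum>i\<in>I. (norm (S (f i)))\<^sup>2) = (\<Sum>i\<in>I. \<Sum>g\<in>G. (S (f i) \<bullet> sgn g)\<^sup>2)"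
    by (intro sum.cong refl norm_eq_sum_inner_sgn G) (auto simp: G(2) intro!: span_base)
  also have "\<dots> = (\<Sum>g\<in>G. \<Sum>i\<in>I. (S (f i) \<bullet> sgn g)\<^sup>2)"
    by (rule sum.swap)
  also have "\<dots> \<le> (\<Sum>g\<in>G. infsum (\<lambda>e. (S e \<bullet> sgn g)\<^sup>2) E)"
    by (intro sum_mono functional_sum_le_orthonormal_basis[OF E lin _ I] finite_sum_le_infsum sums)
       auto
  also have "\<dots> \<le> infsum (\<lambda>e. (norm (S e))\<^sup>2) E"
  proof (rule has_sum_mono)
    show "((\<lambda>e. \<Sum>g\<in>G. (S e \<bullet> sgn g)\<^sup>2) has_sum
        (\<Sum>g\<in>G. infsum (\<lambda>e. (S e \<bullet> sgn g)\<^sup>2) E)) E"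
      by (intro has_sum_sum has_sum_infsum sums)
    show "((\<lambda>e. (norm (S e))\<^sup>2) has_sum infsum (\<lambda>e. (norm (S e))\<^sup>2) E) E"
      using HS by (rule has_sum_infsum)
  qed (rule sum_inner_sgn_le[OF G(1,3)])
  finally show ?thesis .
qed

section \<open>Operators on an orthogonal sum of finite-dimensional blocks\<close>

definition coords :: "('a::euclidean_space \<Rightarrow> 'h::real_inner) \<Rightarrow> 'h \<Rightarrow> 'a" where
  "coords g v = (\<Sum>b\<in>Basis. (v \<bullet> g b) *\<^sub>R b)"

text \<open>This identifies \<open>coords g\<close> as the adjoint of \<open>g\<close>; for an
  isometric block it reads off the component in \<open>range g\<close>.\<close>

lemma coords_inner:
  assumes "linear g"
  shows "coords g v \<bullet> u = v \<bullet> g u"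
proof -
  have "v \<bullet> g u = v \<bullet> g (\<Sum>b\<in>Basis. (u \<bullet> b) *\<^sub>R b)"
    by (simp add: euclidean_representation)
  also have "\<dots> = (\<Sum>b\<in>Basis. (u \<bullet> b) * (v \<bullet> g b))"
    using assms by (simp add: linear_sum linear_scale inner_sum_right)
  finally show ?thesis
    by (simp add: coords_def inner_sum_left inner_commute[of u] mult.commute)
qed

lemma linear_coords: "linear (coords g)"
  unfolding coords_def
  by (rule linearI) (simp_all add: inner_add_left scaleR_add_left sum.distrib scaleR_sum_right)

text \<open>The sort \<open>{real_inner, complete_space}\<close> is not a subsort of \<open>banach\<close>, so the library's
  results on absolutely convergent series do not apply.\<close>

lemma convergent_partial_sums:
  fixes f :: "nat \<Rightarrow> 'k::{real_normed_vector, complete_space}"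
  assumes "summable (\<lambda>n. norm (f n))"
  shows "convergent (\<lambda>n. \<Sum>i<n. f i)"
proof -
  have "Cauchy (\<lambda>n. \<Sum>i<n. f i)"
    unfolding Cauchy_altdef2 dist_norm
  proof (intro allI impI)
    fix \<epsilon> :: real assume "\<epsilon> > 0"
    then obtain N where N: "\<And>m n. m \<ge> N \<Longrightarrow> norm (\<Sum>i=m..<n. norm (f i)) < \<epsilon>"
      using assms unfolding summable_Cauchy by blast
    have "norm ((\<Sum>i<n. f i) - (\<Sum>i<N. f i)) < \<epsilon>" if "n \<ge> N" for n
    proof -
      have "(\<Sum>i<n. f i) - (\<Sum>i<N. f i) = (\<Sum>i=N..<n. f i)"
        using that by (simp add: sum_diff_nat_ivl lessThan_atLeast0)
      then have "norm ((\<Sum>i<n. f i) - (\<Sum>i<N. f i)) \<le> (\<Sum>i=N..<n. norm (f i))"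
        by (simp add: norm_sum)
      also have "\<dots> < \<epsilon>"
        using N[of N n] by simp
      finally show ?thesis .
    qed
    then show "\<exists>N. \<forall>n\<ge>N. norm ((\<Sum>i<n. f i) - (\<Sum>i<N. f i)) < \<epsilon>"
      by blast
  qed
  then show ?thesis
    by (rule Cauchy_convergent)
qed

text \<open>A Hilbert direct sum of copies of one Euclidean space, presented by its embeddings. The
  blocks will be the modes, with \<open>complex \<times> complex\<close> as the Euclidean
  space.\<close>

locale orthogonal_blocks =
  fixes g :: "nat \<Rightarrow> 'a::euclidean_space \<Rightarrow> 'k::{real_inner, complete_space}"
  assumes linear_block: "linear (g m)"
    and block_isometric: "g m u \<bullet> g m v = u \<bullet> v"
    and blocks_orthogonal: "m \<noteq> n \<Longrightarrow> g m u \<bullet> g n v = 0"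
    and blocks_dense: "closure (span (\<Union>m. range (g m))) = UNIV"
begin

lemma norm_block: "norm (g m u) = norm u"
  by (simp add: norm_eq_sqrt_inner block_isometric)

lemma sum_block_inner:
  "finite I \<Longrightarrow> (\<Sum>m\<in>I. g m (u m)) \<bullet> g n v = (if n \<in> I then u n \<bullet> v else 0)"
proof -
  assume I: "finite I"
  have "(\<Sum>m\<in>I. g m (u m)) \<bullet> g n v = (\<Sum>m\<in>I. if m = n then u n \<bullet> v else 0)"
    unfolding inner_sum_left by (intro sum.cong) (auto simp: block_isometric blocks_orthogonal)
  then show ?thesis
    using I by simp
qed

text \<open>The difference is orthogonal to every block, hence by density to itself.\<close>

lemma eq_of_coords_eq:
  assumes "\<And>m. coords (g m) v = coords (g m) w"
  shows "v = w"
proof -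
  have "orthogonal (v - w) x" if "x \<in> (\<Union>m. range (g m))" for x
    using that assms coords_inner[OF linear_block]
    by (auto simp: orthogonal_def inner_diff_left) (metis)
  then have "span (\<Union>m. range (g m)) \<subseteq> {x. (v - w) \<bullet> x = 0}"
    using orthogonal_to_span unfolding orthogonal_def by blast
  moreover have "closed {x. (v - w) \<bullet> x = 0}"
    by (intro closed_Collect_eq continuous_intros)
  ultimately have "closure (span (\<Union>m. range (g m))) \<subseteq> {x. (v - w) \<bullet> x = 0}"
    by (rule closure_minimal)
  then have "(v - w) \<bullet> (v - w) = 0"
    using blocks_dense by blast
  then show ?thesis
    by simp
qed

lemma sum_norm_coords_le: "(\<Sum>m<n. (norm (coords (g m) v))\<^sup>2) \<le> (norm v)\<^sup>2"
proof -
  define p where "p = (\<Sum>m<n. g m (coords (g m) v))"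
  define s where "s = (\<Sum>m<n. (norm (coords (g m) v))\<^sup>2)"
  have "v \<bullet> p = s"
    by (simp add: p_def s_def inner_sum_right coords_inner[OF linear_block, symmetric]
        power2_norm_eq_inner)
  moreover have "p \<bullet> p = s"
    by (subst (2) p_def)
      (simp add: p_def s_def inner_sum_right sum_block_inner power2_norm_eq_inner)
  moreover have "0 \<le> (v - p) \<bullet> (v - p)"
    by simp
  ultimately show ?thesis
    unfolding s_def[symmetric] by (simp add: inner_diff inner_commute[of p v] power2_norm_eq_inner)
qed

lemma summable_norm_coords: "summable (\<lambda>m. (norm (coords (g m) v))\<^sup>2)"
  by (rule summableI_nonneg_bounded[OF _ sum_norm_coords_le]) simp

text \<open>The direct sum of the \<open>d m\<close> is built on the whole space as a limit of
  finite sums. Square summability of the block norms gives its convergence and, as all blocks have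
  the same finite dimension, a finite Hilbert-Schmidt sum.\<close>

lemma block_hilbert_schmidt:
  fixes d :: "nat \<Rightarrow> 'a \<Rightarrow> 'a" and \<kappa> :: "nat \<Rightarrow> real"
  assumes lin: "\<And>m. linear (d m)"
    and bound: "\<And>m u. norm (d m u) \<le> \<kappa> m * norm u"
    and \<kappa>_nonneg: "\<And>m. \<kappa> m \<ge> 0"
    and summable: "summable (\<lambda>m. (\<kappa> m)\<^sup>2)"
  obtains S where "hilbert_schmidt S" "\<And>m v. coords (g m) (S v) = d m (coords (g m) v)"
proof -
  define X where "X v n = (\<Sum>m<n. g m (d m (coords (g m) v)))" for v n
  define S where "S v = lim (X v)" for v
  define K where "K = (\<Sum>m. (\<kappa> m)\<^sup>2)"
  have term_le: "norm (g m (d m (coords (g m) v))) \<le> \<kappa> m * norm (coords (g m) v)" for m v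
    by (simp add: norm_block bound)
  \<comment> \<open>A product of two square summable sequences is summable; the coordinates of
    \<open>v\<close> are square summable by Bessel.\<close>
  have "summable (\<lambda>m. norm (g m (d m (coords (g m) v))))" for v
  proof (rule summable_comparison_test')
    show "summable (\<lambda>m. (\<kappa> m)\<^sup>2 + (norm (coords (g m) v))\<^sup>2)"
      by (intro summable_add summable summable_norm_coords)
    show "norm (norm (g m (d m (coords (g m) v)))) \<le> (\<kappa> m)\<^sup>2 + (norm (coords (g m) v))\<^sup>2" for m
    proof -
      have "\<kappa> m * norm (coords (g m) v) \<le> (\<kappa> m)\<^sup>2 + (norm (coords (g m) v))\<^sup>2"
        using sum_squares_bound[of "\<kappa> m" "norm (coords (g m) v)"]
          mult_nonneg_nonneg[OF \<kappa>_nonneg[of m] norm_ge_zero[of "coords (g m) v"]]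
        by linarith
      then show ?thesis
        using term_le[of m v] by simp
    qed
  qed
  then have lim: "X v \<longlonglongrightarrow> S v" for v
    unfolding X_def S_def by (intro convergent_LIMSEQ_iff[THEN iffD1] convergent_partial_sums)
  have X_bound: "norm (X v n) \<le> norm v * sqrt K" for v n
  proof -
    have "norm (X v n) \<le> (\<Sum>m<n. norm (coords (g m) v) * \<kappa> m)"
      unfolding X_def using term_le by (intro sum_norm_le) (simp add: mult.commute)
    also have "\<dots> \<le> sqrt ((\<Sum>m<n. (norm (coords (g m) v))\<^sup>2) * (\<Sum>m<n. (\<kappa> m)\<^sup>2))"
      by (rule real_le_rsqrt) (rule Cauchy_Schwarz_ineq_sum)
    also have "\<dots> \<le> sqrt ((norm v)\<^sup>2 * K)"
      unfolding K_def
      by (intro real_sqrt_le_mono mult_mono sum_norm_coords_le sum_le_suminf summable sum_nonneg)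
        auto
    finally show ?thesis
      by (simp add: real_sqrt_mult)
  qed
  have S_linear: "linear S"
  proof (rule linearI)
    have X_lin: "linear (\<lambda>v. X v n)" for n
      unfolding X_def
      by (intro linear_compose_sum ballI linear_compose[unfolded o_def, OF linear_coords]
          linear_compose[unfolded o_def, OF lin] linear_block)
    show "S (v + w) = S v + S w" for v w
    proof (rule LIMSEQ_unique[OF lim])
      have "X (v + w) = (\<lambda>n. X v n + X w n)"
        using linear_add[OF X_lin] by blast
      then show "X (v + w) \<longlonglongrightarrow> S v + S w"
        using tendsto_add[OF lim[of v] lim[of w]] by simp
    qed
    show "S (c *\<^sub>R v) = c *\<^sub>R S v" for c v
    proof (rule LIMSEQ_unique[OF lim])
      have "X (c *\<^sub>R v) = (\<lambda>n. c *\<^sub>R X v n)"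
        using linear_scale[OF X_lin] by blast
      then show "X (c *\<^sub>R v) \<longlonglongrightarrow> c *\<^sub>R S v"
        using tendsto_scaleR[OF tendsto_const lim[of v], of c] by simp
    qed
  qed
  have S_bounded: "bounded_linear S"
    using S_linear
  proof (rule bounded_linear_intro[OF linear_add linear_scale])
    show "norm (S v) \<le> norm v * sqrt K" for v
      by (rule LIMSEQ_le_const2[OF tendsto_norm[OF lim]]) (use X_bound in blast)
  qed (auto simp: S_linear)
  have S_coords: "coords (g n) (S v) = d n (coords (g n) v)" for n v
  proof (rule euclidean_eqI)
    fix b :: 'a
    have "(\<lambda>k. X v k \<bullet> g n b) \<longlonglongrightarrow> S v \<bullet> g n b"
      by (intro tendsto_inner lim tendsto_const)
    \<comment> \<open>Once \<open>k > n\<close>, block \<open>n\<close> is in the partial sum and no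
      other block meets it, so the sequence is eventually constant.\<close>
    moreover have "\<forall>\<^sub>F k in sequentially. X v k \<bullet> g n b = d n (coords (g n) v) \<bullet> b"
      unfolding X_def using eventually_gt_at_top[of n]
      by eventually_elim (simp add: sum_block_inner)
    then have "(\<lambda>k. X v k \<bullet> g n b) \<longlonglongrightarrow> d n (coords (g n) v) \<bullet> b"
      by (rule tendsto_eventually)
    ultimately have "S v \<bullet> g n b = d n (coords (g n) v) \<bullet> b"
      by (rule LIMSEQ_unique)
    then show "coords (g n) (S v) \<bullet> b = d n (coords (g n) v) \<bullet> b"
      by (simp add: coords_inner[OF linear_block])
  qed
  have coords_block: "coords (g n) (g m u) = (if m = n then u else 0)" for m n u
    by (rule euclidean_eqI)
      (auto simp: coords_inner[OF linear_block] block_isometric blocks_orthogonal)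
  have S_block: "S (g m u) = g m (d m u)" for m u
    by (rule eq_of_coords_eq) (simp add: S_coords coords_block linear_0[OF lin])
  define E where "E = (\<Union>m. g m ` Basis)"
  have "orthonormal_basis E"
    unfolding orthonormal_basis_def
  proof (intro conjI)
    show "pairwise orthogonal E"
      unfolding E_def pairwise_def orthogonal_def
      by (auto simp: inner_Basis) (metis block_isometric blocks_orthogonal inner_Basis)
    show "\<forall>e\<in>E. norm e = 1"
      by (auto simp: E_def norm_block)
    have "g m u \<in> span E" for m u
    proof -
      have "g m u = (\<Sum>b\<in>Basis. (u \<bullet> b) *\<^sub>R g m b)"
        by (subst euclidean_representation[of u, symmetric])
          (simp only: linear_sum[OF linear_block] linear_scale[OF linear_block])
      also have "\<dots> \<in> span E"
        by (intro span_sum span_mul span_base) (auto simp: E_def)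
      finally show ?thesis .
    qed
    then have "span (\<Union>m. range (g m)) \<subseteq> span E"
      by (intro span_minimal subspace_span) auto
    then show "closure (span E) = UNIV"
      using blocks_dense closure_mono by blast
  qed
  moreover have "(\<lambda>e. (norm (S e))\<^sup>2) summable_on E"
  proof (rule nonneg_bdd_above_summable_on)
    show "bdd_above (sum (\<lambda>e. (norm (S e))\<^sup>2) ` {F. F \<subseteq> E \<and> finite F})"
    proof (rule bdd_aboveI2)
      fix F assume "F \<in> {F. F \<subseteq> E \<and> finite F}"
      then have F: "F \<subseteq> (\<lambda>(m, b). g m b) ` (UNIV \<times> Basis)" "finite F"
        by (auto simp: E_def)
      obtain I where I: "I \<subseteq> UNIV \<times> Basis" "finite I" "F = (\<lambda>(m, b). g m b) ` I"
        using finite_subset_image[OF F(2,1)] by blast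
      obtain n where n: "fst ` I \<subseteq> {..<n}"
        using I(2) by (metis finite_imageI finite_nat_set_iff_bounded lessThan_iff subsetI)
      \<comment> \<open>Passing from \<open>F\<close> to its index set by an inequality avoids
        proving that the indexing by pairs \<open>(m, b)\<close> is injective.\<close>
      have "(\<Sum>e\<in>F. (norm (S e))\<^sup>2) \<le> (\<Sum>(m, b)\<in>I. (norm (S (g m b)))\<^sup>2)"
        unfolding I(3) by (rule order_trans[OF sum_image_le]) (auto simp: I(2) case_prod_beta)
      also have "\<dots> \<le> (\<Sum>(m, b)\<in>{..<n} \<times> Basis. (norm (S (g m b)))\<^sup>2)"
        using I(1) n by (intro sum_mono2) auto
      also have "\<dots> = (\<Sum>m<n. \<Sum>b\<in>Basis. (norm (d m b))\<^sup>2)"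
        by (simp add: sum.cartesian_product S_block norm_block)
      also have "\<dots> \<le> (\<Sum>m<n. \<Sum>b\<in>(Basis::'a set). (\<kappa> m)\<^sup>2)"
        using bound by (intro sum_mono power_mono) (metis mult.right_neutral norm_Basis, simp)
      also have "\<dots> = real DIM('a) * (\<Sum>m<n. (\<kappa> m)\<^sup>2)"
        by (simp add: sum_distrib_left)
      also have "\<dots> \<le> real DIM('a) * K"
        unfolding K_def by (intro mult_left_mono sum_le_suminf summable) auto
      finally show "(\<Sum>e\<in>F. (norm (S e))\<^sup>2) \<le> real DIM('a) * K" .
    qed
  qed auto
  ultimately have "hilbert_schmidt S"
    using S_bounded by (auto simp: hilbert_schmidt_def)
  then show thesis
    using that S_coords by blast
qed

end

section \<open>Summability from quadratic sine weights\<close>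

text \<open>The squared sine has mean 1/2; the oscillating part of the primitive costs at most 1 /
  (2 \<omega>), which the second assumption bounds by (b - a) / 4.\<close>

lemma integral_sin_sq_ge:
  fixes a b \<omega> :: real
  assumes "a < b" "\<omega> * (b - a) \<ge> 2"
  shows "(b - a) / 4 \<le> integral {a..b} (\<lambda>\<tau>. (sin (\<omega> * \<tau>))\<^sup>2)"
proof -
  have "\<omega> > 0"
    using assms by (smt (verit) mult_nonpos_nonneg)
  define F where "F \<tau> = \<tau> / 2 - sin (2 * \<omega> * \<tau>) / (4 * \<omega>)" for \<tau>
  have "((\<lambda>\<tau>. (sin (\<omega> * \<tau>))\<^sup>2) has_integral (F b - F a)) {a..b}"
  proof (rule fundamental_theorem_of_calculus)
    fix \<tau> assume "\<tau> \<in> {a..b}"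
    have "(F has_real_derivative (1 / 2 - cos (2 * (\<omega> * \<tau>)) / 2)) (at \<tau> within {a..b})"
      unfolding F_def using \<open>\<omega> > 0\<close>
      by (auto intro!: derivative_eq_intros simp: field_simps)
    then show "(F has_vector_derivative (sin (\<omega> * \<tau>))\<^sup>2) (at \<tau> within {a..b})"
      by (simp add: has_real_derivative_iff_has_vector_derivative cos_double_sin diff_divide_distrib)
  qed (use assms in auto)
  then have int: "integral {a..b} (\<lambda>\<tau>. (sin (\<omega> * \<tau>))\<^sup>2) = F b - F a"
    by (rule integral_unique)
  have "sin (2 * \<omega> * b) - sin (2 * \<omega> * a) \<le> \<omega> * (b - a)"
    using assms(2) sin_le_one[of "2 * \<omega> * b"] sin_ge_minus_one[of "2 * \<omega> * a"] by linarith
  then have "(sin (2 * \<omega> * b) - sin (2 * \<omega> * a)) / (4 * \<omega>) \<le> \<omega> * (b - a) / (4 * \<omega>)"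
    using \<open>\<omega> > 0\<close> by (intro divide_right_mono) auto
  then show ?thesis
    using \<open>\<omega> > 0\<close> by (simp add: int F_def diff_divide_distrib)
qed

text \<open>At a single \<open>\<tau>\<close> many weights can be small or zero, so \<open>a\<close>
  cannot be bounded there; averaged over an interval, every weight with large \<open>m\<close> is at
  least 1/4.\<close>

lemma summable_of_summable_sin_sq:
  fixes a :: "nat \<Rightarrow> real"
  assumes nonneg: "\<And>m. a m \<ge> 0"
    and summable: "\<And>\<tau>. summable (\<lambda>m. (sin (real m * \<tau>))\<^sup>2 * a m)"
  shows "summable a"
proof -
  define s where "s n \<tau> = (\<Sum>m<n. (sin (real m * \<tau>))\<^sup>2 * a m)" for n \<tau>
  have cont: "continuous_on A (s n)" for A n
    unfolding s_def by (intro continuous_intros)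
  \<comment> \<open>\<open>D N\<close> is the open set where some partial sum exceeds
    \<open>N\<close>. If all of them were dense, Baire would give a point lying in every
    \<open>D N\<close>, where the series would diverge.\<close>
  define D where "D N = (\<Union>n. {\<tau>. s n \<tau> > real N})" for N :: nat
  have openD: "open (D N)" for N
    unfolding D_def by (intro open_UN ballI open_Collect_less cont continuous_intros)
  have "\<exists>N. \<not> UNIV \<subseteq> closure (D N)"
  proof (rule ccontr)
    assume "\<not> ?thesis"
    then have "UNIV \<subseteq> closure (\<Inter>(range D))"
      using openD by (intro Baire) (simp_all, blast)
    then have "\<Inter>(range D) \<noteq> {}"
      by (metis UNIV_not_empty closure_empty subset_empty)
    then obtain \<tau> where \<tau>: "\<tau> \<in> \<Inter>(range D)"
      by blast
    obtain N where N: "(\<Sum>m. (sin (real m * \<tau>))\<^sup>2 * a m) \<le> real N"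
      using real_arch_simple by blast
    have "s n \<tau> \<le> real N" for n
      unfolding s_def by (rule order_trans[OF sum_le_suminf[OF summable] N]) (simp_all add: nonneg)
    moreover have "\<tau> \<in> D N"
      using \<tau> by blast
    ultimately show False
      unfolding D_def by (auto simp: not_le[symmetric])
  qed
  then obtain N where "open (- closure (D N))" "- closure (D N) \<noteq> {}"
    by blast
  then obtain x e where e: "e > 0" "cball x e \<subseteq> - closure (D N)"
    by (meson ex_in_conv open_contains_cball)
  define \<alpha> \<beta> where "\<alpha> = x - e" and "\<beta> = x + e"
  have "\<alpha> < \<beta>"
    using e by (simp add: \<alpha>_def \<beta>_def)
  have bound: "s n \<tau> \<le> real N" if "\<tau> \<in> {\<alpha>..\<beta>}" for n \<tau>
  proof -
    have "\<tau> \<in> cball x e"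
      using that by (auto simp: \<alpha>_def \<beta>_def dist_real_def)
    then have "\<tau> \<notin> D N"
      using e closure_subset by blast
    then show ?thesis
      by (auto simp: D_def not_less)
  qed
  \<comment> \<open>Frequencies below 2 / (\<beta> - \<alpha>) oscillate too slowly for
    \<open>integral_sin_sq_ge\<close>; dropping finitely many terms does not affect
    summability.\<close>
  obtain M :: nat where M: "2 / (\<beta> - \<alpha>) \<le> real M"
    using real_arch_simple by blast
  have "(\<Sum>m<n. a (m + M)) \<le> 4 * real N" for n
  proof -
    have "(\<beta> - \<alpha>) / 4 * (\<Sum>m<n. a (m + M)) = (\<Sum>m\<in>{M..<n + M}. (\<beta> - \<alpha>) / 4 * a m)"
      by (simp add: sum_distrib_left sum.shift_bounds_nat_ivl[of _ 0 M n, simplified] lessThan_atLeast0)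
    also have "\<dots> \<le> (\<Sum>m\<in>{M..<n + M}. integral {\<alpha>..\<beta>} (\<lambda>\<tau>. (sin (real m * \<tau>))\<^sup>2) * a m)"
    proof (intro sum_mono mult_right_mono integral_sin_sq_ge nonneg)
      fix m assume "m \<in> {M..<n + M}"
      then have "2 / (\<beta> - \<alpha>) \<le> real m"
        using M by (simp add: order_trans)
      then show "real m * (\<beta> - \<alpha>) \<ge> 2"
        using \<open>\<alpha> < \<beta>\<close> by (simp add: field_simps)
    qed (use \<open>\<alpha> < \<beta>\<close> in auto)
    also have "\<dots> \<le> (\<Sum>m<n + M. integral {\<alpha>..\<beta>} (\<lambda>\<tau>. (sin (real m * \<tau>))\<^sup>2) * a m)"
      by (intro sum_mono2) (auto intro!: mult_nonneg_nonneg nonneg integral_nonneg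
          integrable_continuous_real continuous_intros)
    also have "\<dots> = integral {\<alpha>..\<beta>} (s (n + M))"
      unfolding s_def
      by (subst integral_sum) (auto intro!: integrable_continuous_real continuous_intros)
    also have "\<dots> \<le> integral {\<alpha>..\<beta>} (\<lambda>_. real N)"
      by (intro integral_le integrable_continuous_real cont continuous_intros bound)
    also have "\<dots> = (\<beta> - \<alpha>) * real N"
      using \<open>\<alpha> < \<beta>\<close> by simp
    finally have "(\<beta> - \<alpha>) * (\<Sum>m<n. a (m + M)) \<le> (\<beta> - \<alpha>) * (4 * real N)"
      by simp
    then show ?thesis
      using \<open>\<alpha> < \<beta>\<close> by (simp only: mult_le_cancel_left_pos diff_gt_0_iff_gt)
  qed
  then have "summable (\<lambda>m. a (m + M))"
    by (intro summableI_nonneg_bounded nonneg)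
  then show ?thesis
    by (simp add: summable_iff_shift)
qed

section \<open>Trigonometric approximation and Fourier coefficients\<close>

text \<open>Negative and zero frequencies are included so that products, with frequencies
  \<open>n + k\<close> and \<open>n - k\<close>, and constants stay in the class; the complex
  amplitude covers sine and cosine at once.\<close>

inductive trig_polynomial :: "(real \<Rightarrow> real) \<Rightarrow> bool" where
  wave: "trig_polynomial (\<lambda>\<theta>. Re (z * cis (of_int n * \<theta>)))"
| add: "trig_polynomial p \<Longrightarrow> trig_polynomial q \<Longrightarrow> trig_polynomial (\<lambda>\<theta>. p \<theta> + q \<theta>)"

lemma trig_polynomial_mult:
  assumes "trig_polynomial p" "trig_polynomial q"
  shows "trig_polynomial (\<lambda>\<theta>. p \<theta> * q \<theta>)"
  using assms(1)
proof induction
  case (wave z n)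
  show ?case
    using assms(2)
  proof induction
    case (wave w k)
    have "Re (z * cis (of_int n * \<theta>)) * Re (w * cis (of_int k * \<theta>)) =
        Re (z * w / 2 * cis (of_int (n + k) * \<theta>)) + Re (z * cnj w / 2 * cis (of_int (n - k) * \<theta>))"
      for \<theta>
    proof -
      have "cis (of_int (n + k) * \<theta>) = cis (of_int n * \<theta>) * cis (of_int k * \<theta>)"
        by (simp add: cis_mult distrib_right)
      moreover have "cis (of_int (n - k) * \<theta>) = cis (of_int n * \<theta>) * cnj (cis (of_int k * \<theta>))"
        by (simp add: cis_cnj cis_mult left_diff_distrib)
      moreover have "Re x * Re y = Re (x * y / 2) + Re (x * cnj y / 2)" for x y
        by (simp add: field_simps)
      from this[of "z * cis (of_int n * \<theta>)" "w * cis (of_int k * \<theta>)"]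
      have "Re (z * cis (of_int n * \<theta>)) * Re (w * cis (of_int k * \<theta>)) =
          Re (z * w / 2 * (cis (of_int n * \<theta>) * cis (of_int k * \<theta>))) +
          Re (z * cnj w / 2 * (cis (of_int n * \<theta>) * cnj (cis (of_int k * \<theta>))))"
        by (simp only: complex_cnj_mult mult_ac times_divide_eq_left times_divide_eq_right)
      ultimately show ?thesis
        by (simp only:)
    qed
    then show ?case
      by (simp only:) (intro trig_polynomial.intros)
  next
    case (add p q)
    then show ?case
      by (simp only: distrib_left) (rule trig_polynomial.add)
  qed
next
  case (add p q)
  then show ?case
    by (simp only: distrib_right) (rule trig_polynomial.add)
qed

lemma trig_polynomial_of_real_polynomial:
  fixes h :: "complex \<Rightarrow> real"
  assumes "real_polynomial_function h"
  shows "trig_polynomial (\<lambda>\<theta>. h (cis \<theta>))"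
  using assms
proof induction
  case (linear h)
  \<comment> \<open>A real-linear \<open>h\<close> turns \<open>cis \<theta>\<close> into a cos
    \<theta> + b sin \<theta> with a = \<open>h 1\<close> and b = \<open>h \<i>\<close>, the real
    part of (a - i b) times \<open>cis \<theta>\<close>.\<close>
  have "h (cis \<theta>) = Re ((Complex (h 1) (- h \<i>)) * cis (of_int 1 * \<theta>))" for \<theta>
  proof -
    have "cis \<theta> = cos \<theta> *\<^sub>R 1 + sin \<theta> *\<^sub>R \<i>"
      by (simp add: complex_eq_iff)
    then have "h (cis \<theta>) = cos \<theta> * h 1 + sin \<theta> * h \<i>"
      using bounded_linear.linear[OF linear] by (simp add: linear_add linear_scale)
    then show ?thesis
      by simp
  qed
  then show ?case
    by (simp only: trig_polynomial.wave)
next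
  case (const c)
  show ?case
    using trig_polynomial.wave[of "of_real c" 0] by simp
next
  case (add f g)
  then show ?case
    by (intro trig_polynomial.add)
next
  case (mult f g)
  then show ?case
    by (intro trig_polynomial_mult)
qed

lemma periodic_shift_int:
  fixes f :: "real \<Rightarrow> 'a"
  assumes "\<And>x. f (x + 2 * pi) = f x"
  shows "f (x + 2 * pi * of_int k) = f x"
proof -
  have nat: "f (x + 2 * pi * real n) = f x" for n x
  proof (induction n)
    case (Suc n)
    then show ?case
      using assms[of "x + 2 * pi * real n"] by (simp add: algebra_simps)
  qed simp
  show ?thesis
  proof (cases "k \<ge> 0")
    case True
    then show ?thesis
      using nat[of x "nat k"] by simp
  next
    case False
    then show ?thesis
      using nat[of "x + 2 * pi * of_int k" "nat (- k)"] by simp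
  qed
qed

lemma periodic_eq_of_cis_eq:
  fixes f :: "real \<Rightarrow> 'a"
  assumes "\<And>x. f (x + 2 * pi) = f x" "cis x = cis y"
  shows "f x = f y"
proof -
  have "sin x = sin y" "cos x = cos y"
    using assms(2) by (auto simp: complex_eq_iff)
  then obtain k where "x = y + 2 * pi * of_int k"
    using sin_cos_eq_iff[of x y] by auto
  then show ?thesis
    using periodic_shift_int[where f = f, OF assms(1)] by simp
qed

text \<open>A periodic \<open>f\<close> is a function \<open>h\<close> on the unit circle.
  Stone-Weierstrass approximates \<open>h\<close> there by real polynomials, which become
  trigonometric ones along \<open>cis\<close>.\<close>

lemma trig_polynomial_approximation:
  fixes f :: "real \<Rightarrow> real"
  assumes cont: "continuous_on UNIV f" and periodic: "\<And>x. f (x + 2 * pi) = f x"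
    and "\<epsilon> > 0"
  obtains p where "trig_polynomial p" "\<And>\<theta>. \<bar>f \<theta> - p \<theta>\<bar> < \<epsilon>"
proof -
  define h where "h w = f (Arg w)" for w
  have cis_Arg2pi: "cis (Arg2pi w) = sgn w" if "w \<noteq> 0" for w
  proof -
    have "w = of_real (norm w) * cis (Arg2pi w)"
      using Arg2pi_eq[of w] by (simp add: cis_conv_exp)
    then have "cis (Arg2pi w) = w / of_real (norm w)"
      using that by (metis nonzero_mult_div_cancel_left norm_eq_zero of_real_eq_0_iff)
    then show ?thesis
      by (simp add: sgn_eq)
  qed
  have h2: "h w = f (Arg2pi w)" if "w \<noteq> 0" for w
    unfolding h_def by (rule periodic_eq_of_cis_eq[where f = f, OF periodic]) (simp add: cis_Arg cis_Arg2pi that)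
  have cont_f: "isCont f x" for x
    using cont by (simp add: continuous_on_eq_continuous_at)
  \<comment> \<open>\<open>Arg\<close> jumps on the negative and \<open>Arg2pi\<close> on the positive real axis; by periodicity both
    describe \<open>h\<close>.\<close>
  have "isCont h w" if "w \<in> sphere 0 1" for w
  proof (cases "w \<in> \<real>\<^sub>\<le>\<^sub>0")
    case False
    then show ?thesis
      unfolding h_def by (intro isCont_o2[OF continuous_at_Arg] cont_f)
  next
    case True
    with that have "w \<notin> \<real>\<^sub>\<ge>\<^sub>0"
      by (auto simp: complex_nonpos_Reals_iff complex_nonneg_Reals_iff complex_eq_iff
          cmod_def)
    then have "isCont (\<lambda>w. f (Arg2pi w)) w"
      by (intro isCont_o2[OF continuous_at_Arg2pi] cont_f)
    moreover have "\<forall>\<^sub>F u in nhds w. h u = f (Arg2pi u)"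
      using that by (intro eventually_mono[OF t1_space_nhds[of w 0]] h2) auto
    ultimately show ?thesis
      by (simp add: isCont_cong)
  qed
  then have "continuous_on (sphere 0 1) h"
    by (simp add: continuous_at_imp_continuous_on)
  then obtain g where g: "real_polynomial_function g" "\<And>w. w \<in> sphere 0 1 \<Longrightarrow> \<bar>h w - g w\<bar> < \<epsilon>"
    using Stone_Weierstrass_real_polynomial_function[OF compact_sphere _ \<open>\<epsilon> > 0\<close>] by blast
  have h_cis: "h (cis \<theta>) = f \<theta>" for \<theta>
    unfolding h_def by (rule periodic_eq_of_cis_eq[where f = f, OF periodic]) (simp add: cis_Arg sgn_eq)
  show thesis
  proof (rule that[OF trig_polynomial_of_real_polynomial[OF g(1)]])
    show "\<bar>f \<theta> - g (cis \<theta>)\<bar> < \<epsilon>" for \<theta>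
      using g(2)[of "cis \<theta>"] by (simp add: h_cis)
  qed
qed

section \<open>Zero-mean circle functions: the L2 pairing and Fourier coefficients\<close>

lemma app_circle_simps:
  "app_circle 0 x = 0"
  "app_circle (f + g) x = app_circle f x + app_circle g x"
  "app_circle (c *\<^sub>R f) x = c * app_circle f x"
  "app_circle (- f) x = - app_circle f x"
  "app_circle (f - g) x = app_circle f x - app_circle g x"
  unfolding minus_circle_fun_def uminus_circle_fun_def zero_circle_fun.rep_eq plus_circle_fun.rep_eq
    scaleR_circle_fun.rep_eq
  by simp_all

lemma app_circle_facts:
  shows smooth_app_circle: "smooth (app_circle f)"
    and app_circle_periodic: "app_circle f (x + 2 * pi) = app_circle f x"
    and integral_app_circle: "integral {0..2 * pi} (app_circle f) = 0"
  using app_circle[of f] by auto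

lemma continuous_on_app_circle [continuous_intros]:
  "continuous_on A h \<Longrightarrow> continuous_on A (\<lambda>x. app_circle f (h x))"
  using continuous_on_compose2[OF smooth_continuous_on[OF smooth_app_circle, of UNIV]] by blast

definition pairing :: "circle_fun \<Rightarrow> circle_fun \<Rightarrow> real" where
  "pairing f g = integral {0..2 * pi} (\<lambda>\<theta>. app_circle f \<theta> * app_circle g \<theta>)"

lemma pairing_commute: "pairing f g = pairing g f"
  by (simp add: pairing_def mult.commute)

lemma linear_pairing: "linear (\<lambda>f. pairing f g)"
proof (rule linearI)
  show "pairing (f + h) g = pairing f g + pairing h g" for f h
    unfolding pairing_def app_circle_simps distrib_right
    by (intro Henstock_Kurzweil_Integration.integral_add integrable_continuous_real continuous_intros)
  show "pairing (c *\<^sub>R f) g = c *\<^sub>R pairing f g" for c f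
    by (simp add: pairing_def app_circle_simps mult.assoc)
qed

lemma linear_pairing_right: "linear (pairing f)"
proof (rule linearI)
  show "pairing f (g + h) = pairing f g + pairing f h" for g h
    using linear_add[OF linear_pairing[of f], of g h] by (simp only: pairing_commute[of _ f])
  show "pairing f (c *\<^sub>R g) = c *\<^sub>R pairing f g" for c g
    using linear_scale[OF linear_pairing[of f], of c g] by (simp only: pairing_commute[of _ f])
qed

lemma pairing_self_nonneg: "pairing f f \<ge> 0"
  unfolding pairing_def
  by (intro integral_nonneg integrable_continuous_real continuous_intros) simp

lemma pairing_self_eq_0:
  assumes "pairing f f = 0"
  shows "f = 0"
proof -
  have "((\<lambda>\<theta>. app_circle f \<theta> * app_circle f \<theta>) has_integral pairing f f) {0..2 * pi}"
    unfolding pairing_def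
    by (intro integrable_integral integrable_continuous_real continuous_intros)
  then have "((\<lambda>\<theta>. app_circle f \<theta> * app_circle f \<theta>) has_integral 0) (cbox 0 (2 * pi))"
    by (simp add: assms)
  then have zero: "app_circle f \<theta> = 0" if "\<theta> \<in> {0..2 * pi}" for \<theta>
    using has_integral_0_cbox_imp_0[of 0 "2 * pi" "\<lambda>\<theta>. app_circle f \<theta> * app_circle f \<theta>" \<theta>] that
      continuous_on_mult[OF continuous_on_app_circle[OF continuous_on_id]
        continuous_on_app_circle[OF continuous_on_id], of "{0..2 * pi}" f f] pi_gt_zero
    by simp
  have "app_circle f x = 0" for x
  proof -
    define k where "k = \<lfloor>x / (2 * pi)\<rfloor>"
    have "of_int k \<le> x / (2 * pi)" "x / (2 * pi) < of_int k + 1"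
      unfolding k_def by linarith+
    then have "of_int k * (2 * pi) \<le> x" "x < (of_int k + 1) * (2 * pi)"
      by (simp_all add: pos_le_divide_eq pos_divide_less_eq)
    then have "x - 2 * pi * of_int k \<in> {0..2 * pi}"
      by (simp add: algebra_simps)
    then show ?thesis
      using zero periodic_shift_int[where f = "app_circle f", OF app_circle_periodic,
          of "x - 2 * pi * of_int k" k] by simp
  qed
  then have "app_circle f = app_circle 0"
    by (simp add: fun_eq_iff app_circle_simps)
  then show ?thesis
    by (simp add: app_circle_inject)
qed

lemma integrable_fourier:
  "(\<lambda>\<theta>. of_real (app_circle f \<theta>) * cis (- (of_int n * \<theta>))) integrable_on {0..2 * pi}"
  by (intro integrable_continuous_real continuous_intros)

lemma linear_fourier_coeff: "linear (\<lambda>f. fourier_coeff f n)"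
proof (rule linearI)
  show "fourier_coeff (f + g) n = fourier_coeff f n + fourier_coeff g n" for f g
    unfolding fourier_coeff_def app_circle_simps of_real_add distrib_right
    by (simp add: Henstock_Kurzweil_Integration.integral_add[OF integrable_fourier integrable_fourier]
        add_divide_distrib)
  show "fourier_coeff (c *\<^sub>R f) n = c *\<^sub>R fourier_coeff f n" for c f
    by (simp add: fourier_coeff_def app_circle_simps mult.assoc scaleR_conv_of_real)
qed

lemma integral_mult_wave:
  "integral {0..2 * pi} (\<lambda>\<theta>. app_circle f \<theta> * Re (z * cis (of_int n * \<theta>))) =
     sqrt (2 * pi) * Re (z * cnj (fourier_coeff f n))"
proof -
  let ?h = "\<lambda>\<theta>. of_real (app_circle f \<theta>) * cis (- (of_int n * \<theta>))"
  have "bounded_linear (\<lambda>c. Re (cnj z * c))"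
    by (rule bounded_linear_compose[OF bounded_linear_Re bounded_linear_mult_right])
  from integral_linear[OF integrable_fourier this, of f n]
  have "integral {0..2 * pi} (\<lambda>\<theta>. Re (cnj z * ?h \<theta>)) = Re (cnj z * integral {0..2 * pi} ?h)"
    by (simp add: o_def)
  also have "integral {0..2 * pi} ?h = of_real (sqrt (2 * pi)) * fourier_coeff f n"
    by (simp add: fourier_coeff_def)
  finally show ?thesis
    by (simp add: algebra_simps)
qed

lemma fourier_coeff_0: "fourier_coeff f 0 = 0"
proof -
  have "((\<lambda>\<theta>. of_real (app_circle f \<theta>)) has_integral (of_real 0 :: complex)) {0..2 * pi}"
    using integrable_integral[OF smooth_integrable[OF smooth_app_circle[of f]], of 0 "2 * pi"]
    unfolding integral_app_circle by (rule has_integral_of_real)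
  then show ?thesis
    by (simp add: fourier_coeff_def integral_unique)
qed

text \<open>Reality of \<open>f\<close>. Together with the vanishing zero mode it reduces all
  coefficients to those of positive index, the only ones that \<open>b_pos\<close> and
  \<open>b_neg_star\<close> see for \<open>m \<ge> 1\<close>.\<close>

lemma fourier_coeff_uminus: "fourier_coeff f (- n) = cnj (fourier_coeff f n)"
proof -
  let ?h = "\<lambda>\<theta>. of_real (app_circle f \<theta>) * cis (- (of_int n * \<theta>))"
  have "fourier_coeff f (- n) = integral {0..2 * pi} (\<lambda>\<theta>. cnj (?h \<theta>)) / of_real (sqrt (2 * pi))"
    unfolding fourier_coeff_def complex_cnj_mult complex_cnj_complex_of_real cis_cnj by simp
  moreover have "integral {0..2 * pi} (\<lambda>\<theta>. cnj (?h \<theta>)) = cnj (integral {0..2 * pi} ?h)"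
    using integral_linear[OF integrable_fourier[of f n] bounded_linear_cnj] by (simp only: o_def)
  ultimately show ?thesis
    unfolding fourier_coeff_def by (simp only: complex_cnj_divide complex_cnj_complex_of_real)
qed

text \<open>Differentiation multiplies the amplitude by i a, so derivatives of all orders are again
  of this form.\<close>

lemma smooth_wave: "smooth (\<lambda>\<theta>. Re (z * cis (a * \<theta>)))"
proof -
  have deriv: "((\<lambda>\<theta>. Re (w * cis (a * \<theta>))) has_real_derivative Re (w * (\<i> * of_real a) * cis (a * \<theta>)))
      (at \<theta>)" for w \<theta>
    by (auto intro!: derivative_eq_intros simp: algebra_simps)
  have "(deriv ^^ k) (\<lambda>\<theta>. Re (z * cis (a * \<theta>))) = (\<lambda>\<theta>. Re (z * (\<i> * of_real a) ^ k * cis (a * \<theta>)))" for k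
  proof (induction k)
    case (Suc k)
    have "deriv (\<lambda>\<theta>. Re (z * (\<i> * of_real a) ^ k * cis (a * \<theta>))) =
        (\<lambda>\<theta>. Re (z * (\<i> * of_real a) ^ k * (\<i> * of_real a) * cis (a * \<theta>)))"
      by (intro ext DERIV_imp_deriv deriv)
    then show ?case
      by (simp only: funpow.simps o_def Suc power_Suc2 mult.assoc)
  qed simp
  then show ?thesis
    unfolding smooth_def real_differentiable_def by (simp only:) (intro allI exI, rule deriv)
qed

lemma has_integral_cis:
  "((\<lambda>\<theta>. cis (of_int k * \<theta>)) has_integral (if k = 0 then of_real (2 * pi) else 0)) {0..2 * pi}"
proof (cases "k = 0")
  case True
  then show ?thesis
    using has_integral_const_real[of "1::complex" 0 "2 * pi"] by (simp add: scaleR_conv_of_real)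
next
  case False
  let ?F = "\<lambda>\<theta>. cis (of_int k * \<theta>) / (\<i> * of_int k)"
  have "((\<lambda>\<theta>. cis (of_int k * \<theta>)) has_integral (?F (2 * pi) - ?F 0)) {0..2 * pi}"
  proof (rule fundamental_theorem_of_calculus)
    fix \<theta> :: real
    have "((\<lambda>w. exp (\<i> * of_int k * w) / (\<i> * of_int k)) has_field_derivative
        exp (\<i> * of_int k * of_real \<theta>)) (at (of_real \<theta>))"
      using False by (auto intro!: derivative_eq_intros)
    from has_vector_derivative_real_field[OF this, of "{0..2 * pi}"]
    show "(?F has_vector_derivative cis (of_int k * \<theta>)) (at \<theta> within {0..2 * pi})"
      by (simp add: cis_conv_exp mult.assoc)
  qed simp
  moreover have "cis (of_int k * (2 * pi)) = 1"
    using cis_multiple_2pi[of "of_int k"] by (subst mult.commute) simp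
  then have "?F (2 * pi) = ?F 0"
    by simp
  ultimately show ?thesis
    using False by simp
qed

text \<open>Normalized so that the coefficient with index \<open>n\<close> is \<open>z\<close>; the value at \<open>n = 0\<close> is junk, chosen
  to have zero mean.\<close>

lift_definition wave :: "nat \<Rightarrow> complex \<Rightarrow> circle_fun"
  is "\<lambda>n z \<theta>. if n = 0 then 0 else 2 / sqrt (2 * pi) * Re (z * cis (real n * \<theta>))"
proof -
  fix n :: nat and z :: complex
  show "smooth (\<lambda>\<theta>. if n = 0 then 0 else 2 / sqrt (2 * pi) * Re (z * cis (real n * \<theta>))) \<and>
    (\<forall>x. (if n = 0 then 0 else 2 / sqrt (2 * pi) * Re (z * cis (real n * (x + 2 * pi)))) =
       (if n = 0 then 0 else 2 / sqrt (2 * pi) * Re (z * cis (real n * x)))) \<and>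
    integral {0..2 * pi} (\<lambda>\<theta>. if n = 0 then 0 else 2 / sqrt (2 * pi) * Re (z * cis (real n * \<theta>))) = 0"
  proof (cases "n = 0")
    case False
    have "cis (real n * (x + 2 * pi)) = cis (real n * x)" for x
    proof -
      have "cis (real n * (x + 2 * pi)) = cis (real n * x + 2 * pi * real n)"
        by (simp only: distrib_left mult_ac)
      also have "\<dots> = cis (real n * x) * cis (2 * pi * real n)"
        by (rule cis_mult[symmetric])
      finally show ?thesis
        by (simp add: cis_multiple_2pi)
    qed
    moreover have "integral {0..2 * pi} (\<lambda>\<theta>. Re (z * cis (real n * \<theta>))) = 0"
    proof -
      have "((\<lambda>\<theta>. Re (z * cis (of_int (int n) * \<theta>))) has_integral Re (z * 0)) {0..2 * pi}"
        using has_integral_linear[OF has_integral_cis[of "int n"]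
            bounded_linear_compose[OF bounded_linear_Re bounded_linear_mult_right[of z]]] False
        by (simp add: o_def del: times_complex.sel)
      then show ?thesis
        by (simp add: integral_unique)
    qed
    moreover have "smooth (\<lambda>\<theta>. 2 / sqrt (2 * pi) * Re (z * cis (real n * \<theta>)))"
      by (rule smooth_cmult[OF smooth_wave])
    ultimately show ?thesis
      using False by (simp del: times_complex.sel)
  qed (simp add: smooth_zero)
qed

text \<open>The real part carries the frequencies \<open>n\<close> and \<open>- n\<close>; only the
  first can meet a positive index \<open>m\<close>.\<close>

lemma fourier_coeff_wave:
  assumes "n \<ge> 1" "m \<ge> 1"
  shows "fourier_coeff (wave n z) (int m) = (if n = m then z else 0)"
proof -
  let ?c = "\<lambda>k \<theta>. cis (of_int k * \<theta>)"
  have "complex_of_real (app_circle (wave n z) \<theta>) * cis (- (of_int (int m) * \<theta>)) =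
      of_real (1 / sqrt (2 * pi)) * (z * ?c (int n - int m) \<theta> + cnj z * ?c (- int n - int m) \<theta>)" for \<theta>
  proof -
    have "of_real (2 * Re (z * cis (real n * \<theta>))) = z * cis (real n * \<theta>) + cnj z * cis (- (real n * \<theta>))"
      by (simp add: complex_eq_iff)
    moreover have "?c (int n - int m) \<theta> = cis (real n * \<theta>) * cis (- (of_int (int m) * \<theta>))"
      "?c (- int n - int m) \<theta> = cis (- (real n * \<theta>)) * cis (- (of_int (int m) * \<theta>))"
      by (simp_all add: cis_mult left_diff_distrib)
    moreover have "complex_of_real (app_circle (wave n z) \<theta>) =
        of_real (1 / sqrt (2 * pi)) * of_real (2 * Re (z * cis (real n * \<theta>)))"
      using assms unfolding of_real_mult[symmetric] by (simp add: wave.rep_eq)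
    ultimately show ?thesis
      by (simp only: distrib_right mult.assoc)
  qed
  moreover have "((\<lambda>\<theta>. of_real (1 / sqrt (2 * pi)) *
      (z * ?c (int n - int m) \<theta> + cnj z * ?c (- int n - int m) \<theta>)) has_integral
      of_real (1 / sqrt (2 * pi)) * (z * (if int n - int m = 0 then of_real (2 * pi) else 0)
        + cnj z * (if - int n - int m = 0 then of_real (2 * pi) else 0))) {0..2 * pi}"
    by (intro has_integral_mult_right has_integral_add has_integral_cis)
  ultimately have "fourier_coeff (wave n z) (int m) = of_real (1 / sqrt (2 * pi)) * (z *
      (if int n - int m = 0 then of_real (2 * pi) else 0)
      + cnj z * (if - int n - int m = 0 then of_real (2 * pi) else 0)) / of_real (sqrt (2 * pi))"
    unfolding fourier_coeff_def by (simp only: integral_unique)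
  moreover have "complex_of_real (sqrt (2 * pi)) * of_real (sqrt (2 * pi)) = of_real (2 * pi)"
    unfolding of_real_mult[symmetric] by simp
  ultimately show ?thesis
    using assms by (auto simp: field_simps)
qed

lemma pairing_wave:
  assumes "n \<ge> 1"
  shows "pairing (wave n z) f = 2 * Re (z * cnj (fourier_coeff f (int n)))"
proof -
  have "pairing (wave n z) f = 2 / sqrt (2 * pi) *
      integral {0..2 * pi} (\<lambda>\<theta>. app_circle f \<theta> * Re (z * cis (of_int (int n) * \<theta>)))"
    unfolding pairing_def using assms
    by (subst Henstock_Kurzweil_Integration.integral_mult_right[symmetric])
      (intro integral_cong, simp add: wave.rep_eq)
  also have "\<dots> = 2 * Re (z * cnj (fourier_coeff f (int n)))"
    unfolding integral_mult_wave by simp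
  finally show ?thesis .
qed

lemma linear_wave: "linear (wave n)"
  by (rule linearI; transfer) (auto simp: fun_eq_iff algebra_simps)

text \<open>This is the symmetric Fourier sum over indices from \<open>- N\<close> to
  \<open>N\<close>: \<open>wave n\<close> contains both \<open>n\<close> and \<open>- n\<close>, and
  index 0 is absent by zero mean.\<close>

definition partial_sum :: "nat \<Rightarrow> circle_fun \<Rightarrow> circle_fun" where
  "partial_sum N f = (\<Sum>n=1..N. wave n (fourier_coeff f (int n)))"

lemma fourier_coeff_partial_sum:
  assumes "m \<ge> 1"
  shows "fourier_coeff (partial_sum N f) (int m) = (if m \<le> N then fourier_coeff f (int m) else 0)"
proof -
  have "fourier_coeff (partial_sum N f) (int m) =
      (\<Sum>n=1..N. if n = m then fourier_coeff f (int m) else 0)"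
    unfolding partial_sum_def linear_sum[OF linear_fourier_coeff]
    using assms by (intro sum.cong) (auto simp: fourier_coeff_wave)
  then show ?thesis
    using assms by simp
qed

text \<open>\<open>N\<close> depends on \<open>p\<close> alone, so it serves all Fourier remainders
  at once. Continuity is carried along because the case of a sum splits an integral.\<close>

lemma trig_polynomial_orthogonal:
  assumes "trig_polynomial p"
  shows "continuous_on UNIV p \<and> (\<exists>N. \<forall>r. (\<forall>n. 1 \<le> n \<and> n \<le> N \<longrightarrow> fourier_coeff r (int n) = 0) \<longrightarrow>
    integral {0..2 * pi} (\<lambda>\<theta>. app_circle r \<theta> * p \<theta>) = 0)"
  using assms
proof induction
  case (wave z n)
  have "fourier_coeff r n = 0"
    if r: "\<forall>k. 1 \<le> k \<and> k \<le> nat \<bar>n\<bar> \<longrightarrow> fourier_coeff r (int k) = 0" for r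
  proof (cases "n = 0")
    case True
    then show ?thesis
      by (simp add: fourier_coeff_0)
  next
    case False
    then have "fourier_coeff r \<bar>n\<bar> = 0"
      using r[rule_format, of "nat \<bar>n\<bar>"] by simp
    then show ?thesis
      using fourier_coeff_uminus[of r "\<bar>n\<bar>"] by (cases "n \<ge> 0") auto
  qed
  then show ?case
    unfolding integral_mult_wave by (auto intro!: continuous_intros exI[of _ "nat \<bar>n\<bar>"])
next
  case (add p q)
  obtain N where
    N: "\<And>r. (\<forall>n. 1 \<le> n \<and> n \<le> N \<longrightarrow> fourier_coeff r (int n) = 0) \<Longrightarrow>
      integral {0..2 * pi} (\<lambda>\<theta>. app_circle r \<theta> * p \<theta>) = 0"
    using add.IH(1) by blast
  obtain M where
    M: "\<And>r. (\<forall>n. 1 \<le> n \<and> n \<le> M \<longrightarrow> fourier_coeff r (int n) = 0) \<Longrightarrow>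
      integral {0..2 * pi} (\<lambda>\<theta>. app_circle r \<theta> * q \<theta>) = 0"
    using add.IH(2) by blast
  have cont: "continuous_on A p" "continuous_on A q" for A
    using add.IH continuous_on_subset by blast+
  have "integral {0..2 * pi} (\<lambda>\<theta>. app_circle r \<theta> * (p \<theta> + q \<theta>)) = 0"
    if "\<forall>n. 1 \<le> n \<and> n \<le> max N M \<longrightarrow> fourier_coeff r (int n) = 0" for r
  proof -
    have "integral {0..2 * pi} (\<lambda>\<theta>. app_circle r \<theta> * p \<theta>) = 0"
      "integral {0..2 * pi} (\<lambda>\<theta>. app_circle r \<theta> * q \<theta>) = 0"
      using that by (auto intro!: N M)
    moreover have "(\<lambda>\<theta>. app_circle r \<theta> * p \<theta>) integrable_on {0..2 * pi}"
      "(\<lambda>\<theta>. app_circle r \<theta> * q \<theta>) integrable_on {0..2 * pi}"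
      by (intro integrable_continuous_real continuous_intros cont)+
    ultimately show ?thesis
      by (simp add: distrib_left Henstock_Kurzweil_Integration.integral_add)
  qed
  then show ?case
    by (auto intro!: continuous_intros cont)
qed

text \<open>Weak convergence of Fourier sums: the remainders are bounded in L2 by Bessel and
  eventually orthogonal to any trigonometric polynomial, and such a polynomial can be taken
  uniformly close to \<open>g\<close>.\<close>

lemma pairing_remainder_tendsto_0:
  "(\<lambda>N. pairing (f - partial_sum N f) g) \<longlonglongrightarrow> 0"
proof (rule LIMSEQ_I)
  fix \<epsilon> :: real assume "\<epsilon> > 0"
  define r where "r N = f - partial_sum N f" for N
  \<comment> \<open>The bound |r| <= r^2 + 1, integrated over a period of length 2 pi, stands in for
    Cauchy-Schwarz and produces this constant.\<close>
  define C where "C = pairing f f + 2 * pi"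
  have "C > 0"
    unfolding C_def using pairing_self_nonneg[of f] pi_gt_zero by linarith
  have coeff_r: "fourier_coeff (r N) (int n) = 0" if "1 \<le> n" "n \<le> N" for n N
    unfolding r_def using that
    by (simp add: linear_diff[OF linear_fourier_coeff] fourier_coeff_partial_sum)
  have bessel: "pairing (r N) (r N) \<le> pairing f f" for N
  proof -
    have orth: "pairing (partial_sum N f) (r N) = 0"
      unfolding partial_sum_def linear_sum[OF linear_pairing] using coeff_r
      by (intro sum.neutral) (auto simp: pairing_wave)
    have "pairing (r N + partial_sum N f) (r N + partial_sum N f) =
        pairing (r N) (r N) + pairing (partial_sum N f) (partial_sum N f)"
      using orth pairing_commute[of "r N" "partial_sum N f"]
      by (simp add: linear_add[OF linear_pairing] linear_add[OF linear_pairing_right])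
    then have "pairing f f = pairing (r N) (r N) + pairing (partial_sum N f) (partial_sum N f)"
      by (simp add: r_def)
    then show ?thesis
      using pairing_self_nonneg[of "partial_sum N f"] by linarith
  qed
  define \<delta> where "\<delta> = \<epsilon> / (2 * C)"
  have "\<delta> > 0"
    using \<open>\<epsilon> > 0\<close> \<open>C > 0\<close> by (simp add: \<delta>_def)
  obtain p where p: "trig_polynomial p" "\<And>\<theta>. \<bar>app_circle g \<theta> - p \<theta>\<bar> < \<delta>"
    using trig_polynomial_approximation[OF smooth_continuous_on[OF smooth_app_circle[of g]]
        app_circle_periodic \<open>\<delta> > 0\<close>] by blast
  obtain N where cont_p: "continuous_on UNIV p" and
    N: "\<And>r. (\<forall>n. 1 \<le> n \<and> n \<le> N \<longrightarrow> fourier_coeff r (int n) = 0) \<Longrightarrow>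
      integral {0..2 * pi} (\<lambda>\<theta>. app_circle r \<theta> * p \<theta>) = 0"
    using trig_polynomial_orthogonal[OF p(1)] by blast
  have cont_p': "continuous_on A p" for A
    using cont_p continuous_on_subset by blast
  have "norm (pairing (r M) g - 0) < \<epsilon>" if "M \<ge> N" for M
  proof -
    let ?r = "app_circle (r M)"
    have "pairing (r M) g = integral {0..2 * pi} (\<lambda>\<theta>. ?r \<theta> * app_circle g \<theta>)
        - integral {0..2 * pi} (\<lambda>\<theta>. ?r \<theta> * p \<theta>)"
      using N[of "r M"] coeff_r that by (simp add: pairing_def)
    also have "\<dots> = integral {0..2 * pi} (\<lambda>\<theta>. ?r \<theta> * (app_circle g \<theta> - p \<theta>))"
      unfolding right_diff_distrib
      by (intro Henstock_Kurzweil_Integration.integral_diff[symmetric]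
          integrable_continuous_real continuous_intros cont_p')
    also have "norm \<dots> \<le> integral {0..2 * pi} (\<lambda>\<theta>. \<delta> * (?r \<theta> * ?r \<theta> + 1))"
    proof (rule integral_norm_bound_integral)
      show "norm (?r \<theta> * (app_circle g \<theta> - p \<theta>)) \<le> \<delta> * (?r \<theta> * ?r \<theta> + 1)" for \<theta>
      proof -
        have "\<bar>?r \<theta>\<bar> \<le> ?r \<theta> * ?r \<theta> + 1"
          using sum_squares_bound[of "\<bar>?r \<theta>\<bar>" 1] by (simp add: power2_eq_square)
        then have "\<bar>?r \<theta>\<bar> * \<bar>app_circle g \<theta> - p \<theta>\<bar> \<le> (?r \<theta> * ?r \<theta> + 1) * \<delta>"
          using p(2)[of \<theta>] by (intro mult_mono) auto
        then show ?thesis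
          by (simp add: abs_mult mult.commute)
      qed
    qed (intro integrable_continuous_real continuous_intros cont_p')+
    also have "\<dots> = \<delta> * (integral {0..2 * pi} (\<lambda>\<theta>. ?r \<theta> * ?r \<theta>) + 2 * pi)"
      unfolding Henstock_Kurzweil_Integration.integral_mult_right
      by (subst Henstock_Kurzweil_Integration.integral_add)
        (auto intro!: integrable_continuous_real continuous_intros)
    also have "\<dots> \<le> \<delta> * C"
      using bessel[of M] \<open>\<delta> > 0\<close> unfolding C_def pairing_def[symmetric]
      by (intro mult_left_mono) auto
    also have "\<dots> < \<epsilon>"
      using \<open>\<epsilon> > 0\<close> \<open>C > 0\<close> by (simp add: \<delta>_def)
    finally show ?thesis
      by simp
  qed
  then show "\<exists>N. \<forall>M\<ge>N. norm (pairing (f - partial_sum M f) g - 0) < \<epsilon>"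
    unfolding r_def by blast
qed

text \<open>All partial sums of \<open>f - g\<close> vanish, so the weak limit tested against
  \<open>f - g\<close> itself says that its L2 norm is zero.\<close>

lemma circle_fun_eqI:
  assumes "\<And>n. n \<ge> 1 \<Longrightarrow> fourier_coeff f (int n) = fourier_coeff g (int n)"
  shows "f = g"
proof -
  have "partial_sum N (f - g) = 0" for N
    unfolding partial_sum_def using assms
    by (intro sum.neutral) (auto simp: linear_diff[OF linear_fourier_coeff] linear_0[OF linear_wave])
  then have "pairing (f - g) (f - g) = 0"
    using pairing_remainder_tendsto_0[of "f - g" "f - g"] by (simp add: LIMSEQ_const_iff)
  then show ?thesis
    using pairing_self_eq_0 by fastforce
qed

section \<open>Modes\<close>

text \<open>These are the first two entries of \<open>B m x\<close>; the other two are their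
  conjugates in reverse order, so the pair holds all of mode \<open>m\<close>.\<close>

definition beta :: "nat \<Rightarrow> phase \<Rightarrow> complex \<times> complex" where
  "beta m x = (b_pos m x, b_neg_star m x)"

text \<open>The factors come from solving the formulas for \<open>b_pos\<close> and
  \<open>b_neg_star\<close> for the two Fourier coefficients, so that \<open>mode m\<close> is a
  right inverse of \<open>beta m\<close> for \<open>m \<ge> 1\<close>.\<close>

definition mode :: "nat \<Rightarrow> complex \<times> complex \<Rightarrow> phase" where
  "mode m u = (wave m (of_real (1 / sqrt (2 * real m)) * (fst u + snd u)),
     wave m (- \<i> * of_real (sqrt (2 * real m) / 2) * (fst u - snd u)))"

text \<open>\<open>Omega x y\<close> is the sum over \<open>m\<close> of \<open>mode_form (beta m x) (beta m y)\<close>.\<close>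

definition mode_form :: "complex \<times> complex \<Rightarrow> complex \<times> complex \<Rightarrow> real" where
  "mode_form u v = 2 * Im (fst u * cnj (fst v) - snd u * cnj (snd v))"

lemma fourier_coeff_add: "fourier_coeff (f + g) n = fourier_coeff f n + fourier_coeff g n"
  using linear_add[OF linear_fourier_coeff[of n], of f g] .

lemma fourier_coeff_scaleR: "fourier_coeff (c *\<^sub>R f) n = of_real c * fourier_coeff f n"
  using linear_scale[OF linear_fourier_coeff[of n], of c f] by (simp add: scaleR_conv_of_real)

lemma linear_beta: "linear (beta m)"
proof (rule linearI)
  show "beta m (x + y) = beta m x + beta m y" for x y
    by (simp add: beta_def b_pos_def b_neg_star_def fourier_coeff_add add_divide_distrib
        diff_divide_distrib algebra_simps)
  show "beta m (c *\<^sub>R x) = c *\<^sub>R beta m x" for c x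
    by (simp add: beta_def b_pos_def b_neg_star_def fourier_coeff_scaleR scaleR_conv_of_real
        algebra_simps)
qed

lemma linear_mode: "linear (mode m)"
proof (rule linearI)
  have add: "wave m (k * (a + b)) = wave m (k * a) + wave m (k * b)" for k a b
    by (simp add: distrib_left linear_add[OF linear_wave])
  have scale: "wave m (k * (c *\<^sub>R a)) = c *\<^sub>R wave m (k * a)" for k a c
    by (simp add: linear_scale[OF linear_wave])
  show "mode m (u + v) = mode m u + mode m v" for u v
  proof -
    have "fst u + fst v + (snd u + snd v) = fst u + snd u + (fst v + snd v)"
      "fst u + fst v - (snd u + snd v) = fst u - snd u + (fst v - snd v)"
      by simp_all
    then show ?thesis
      by (simp only: mode_def fst_add snd_add add) simp
  qed
  show "mode m (c *\<^sub>R u) = c *\<^sub>R mode m u" for c u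
    by (simp only: mode_def fst_scaleR snd_scaleR scaleR_add_right[symmetric]
        scaleR_diff_right[symmetric] scale scaleR_Pair)
qed

lemma fourier_coeff_beta:
  assumes "m \<ge> 1"
  shows "fourier_coeff (fst x) (int m) = of_real (1 / sqrt (2 * real m)) * (b_pos m x + b_neg_star m x)"
    and "fourier_coeff (snd x) (int m) =
      - \<i> * of_real (sqrt (2 * real m) / 2) * (b_pos m x - b_neg_star m x)"
proof -
  define s where "s = complex_of_real (sqrt (2 * real m))"
  have s: "s * s = 2 * of_nat m" "s \<noteq> 0"
    using assms unfolding s_def of_real_mult[symmetric] by simp_all
  then have inv: "1 / s * (of_nat m / s) = 1 / 2"
    using assms by (simp add: field_simps)
  have "b_pos m x + b_neg_star m x = 2 * (of_nat m / s) * fourier_coeff (fst x) (int m)"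
    by (simp add: b_pos_def b_neg_star_def s_def add_divide_distrib diff_divide_distrib)
  then have "1 / s * (b_pos m x + b_neg_star m x) =
      2 * (1 / s * (of_nat m / s)) * fourier_coeff (fst x) (int m)"
    by (simp only: mult_ac)
  then show "fourier_coeff (fst x) (int m) =
      of_real (1 / sqrt (2 * real m)) * (b_pos m x + b_neg_star m x)"
    unfolding inv by (simp add: s_def)
  have "b_pos m x - b_neg_star m x = 2 * \<i> / s * fourier_coeff (snd x) (int m)"
    by (simp add: b_pos_def b_neg_star_def s_def add_divide_distrib diff_divide_distrib)
  then have "- \<i> * (s / 2) * (b_pos m x - b_neg_star m x) = fourier_coeff (snd x) (int m)"
    using s(2) by (simp add: field_simps)
  then show "fourier_coeff (snd x) (int m) =
      - \<i> * of_real (sqrt (2 * real m) / 2) * (b_pos m x - b_neg_star m x)"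
    by (simp add: s_def)
qed

lemma beta_mode:
  assumes "m \<ge> 1" "n \<ge> 1"
  shows "beta n (mode m u) = (if n = m then u else 0)"
proof (cases "n = m")
  case True
  define s where "s = complex_of_real (sqrt (2 * real m))"
  have s: "s * s = 2 * of_nat m" "s \<noteq> 0"
    using assms unfolding s_def of_real_mult[symmetric] by simp_all
  have m: "of_nat m = s * s / 2"
    using s by simp
  have inv: "complex_of_real (1 / sqrt (2 * real m)) = 1 / s"
    and half: "complex_of_real (sqrt (2 * real m) / 2) = s / 2"
    by (simp_all add: s_def)
  have "b_pos m (mode m u) = fst u" "b_neg_star m (mode m u) = snd u"
    using s(2) unfolding b_pos_def b_neg_star_def mode_def fst_conv snd_conv
      fourier_coeff_wave[OF assms(1,1)] inv half s_def[symmetric] m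
    by (simp_all add: field_simps)
  then show ?thesis
    using True by (simp add: beta_def)
next
  case False
  then show ?thesis
    using assms by (simp add: beta_def b_pos_def b_neg_star_def mode_def fourier_coeff_wave zero_prod_def)
qed

lemma phase_eqI:
  assumes "\<And>m. m \<ge> 1 \<Longrightarrow> beta m x = beta m y"
  shows "x = y"
proof (rule prod_eqI)
  show "fst x = fst y"
    using assms by (intro circle_fun_eqI) (simp add: fourier_coeff_beta beta_def)
  show "snd x = snd y"
    using assms by (intro circle_fun_eqI) (simp add: fourier_coeff_beta beta_def)
qed

lemma Omega_pairing: "Omega x y = pairing (fst y) (snd x) - pairing (fst x) (snd y)"
  unfolding Omega_def pairing_def
  by (intro Henstock_Kurzweil_Integration.integral_diff integrable_continuous_real continuous_intros)

lemma Omega_linear_left: "linear (\<lambda>x. Omega x y)"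
  unfolding Omega_pairing
  by (rule linearI) (simp_all add: linear_add[OF linear_pairing] linear_add[OF linear_pairing_right]
      linear_scale[OF linear_pairing] linear_scale[OF linear_pairing_right] algebra_simps)

lemma Omega_antisym: "Omega x y = - Omega y x"
  by (simp add: Omega_pairing)

lemma Omega_linear_right: "linear (Omega x)"
proof (rule linearI)
  show "Omega x (y + z) = Omega x y + Omega x z" for y z
    using linear_add[OF Omega_linear_left[of x], of y z]
    by (simp add: Omega_antisym[of x])
  show "Omega x (c *\<^sub>R y) = c *\<^sub>R Omega x y" for c y
    using linear_scale[OF Omega_linear_left[of x], of c y]
    by (simp add: Omega_antisym[of x])
qed

text \<open>Pairing with a wave reads off a single Fourier coefficient, so no infinite sum over
  modes has to be evaluated.\<close>

lemma Omega_mode: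
  assumes "m \<ge> 1"
  shows "Omega (mode m u) x = mode_form u (beta m x)"
proof -
  define s where "s = sqrt (2 * real m)"
  have s: "s \<noteq> 0"
    using assms by (simp add: s_def)
  have xi: "fourier_coeff (fst x) (int m) = of_real (1 / s) * (b_pos m x + b_neg_star m x)"
    and P: "fourier_coeff (snd x) (int m) = - \<i> * of_real (s / 2) * (b_pos m x - b_neg_star m x)"
    using fourier_coeff_beta[OF assms, of x] by (simp_all add: s_def)
  have "Omega (mode m u) x =
      2 * Re (- \<i> * of_real (s / 2) * (fst u - snd u) * cnj (fourier_coeff (fst x) (int m)))
      - 2 * Re (of_real (1 / s) * (fst u + snd u) * cnj (fourier_coeff (snd x) (int m)))"
    unfolding Omega_pairing mode_def fst_conv snd_conv pairing_commute[of "fst x"]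
      pairing_wave[OF assms] s_def[symmetric] ..
  also have "\<dots> = mode_form u (beta m x)"
    unfolding xi P mode_form_def beta_def using s by (simp add: field_simps)
  finally show ?thesis .
qed

lemma mode_form_nondegenerate:
  assumes "\<And>u. mode_form u v = mode_form u w"
  shows "v = w"
proof -
  have "mode_form (1, 0) v = mode_form (1, 0) w" "mode_form (\<i>, 0) v = mode_form (\<i>, 0) w"
    "mode_form (0, 1) v = mode_form (0, 1) w" "mode_form (0, \<i>) v = mode_form (0, \<i>) w"
    by (rule assms)+
  then show ?thesis
    by (simp add: mode_form_def prod_eq_iff complex_eq_iff)
qed

definition mode_projection :: "nat \<Rightarrow> phase \<Rightarrow> phase" where
  "mode_projection N x = (\<Sum>m=1..N. mode m (beta m x))"

lemma mode_projection_partial_sum: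
  "mode_projection N x = (partial_sum N (fst x), partial_sum N (snd x))"
proof -
  have "mode m (beta m x) = (wave m (fourier_coeff (fst x) (int m)), wave m (fourier_coeff (snd x) (int m)))"
    if "m \<ge> 1" for m
    using that by (simp add: mode_def beta_def fourier_coeff_beta)
  then show ?thesis
    by (simp add: mode_projection_def partial_sum_def sum_prod)
qed

lemma Omega_remainder_tendsto_0: "(\<lambda>N. Omega (x - mode_projection N x) y) \<longlonglongrightarrow> 0"
proof -
  have "(\<lambda>N. pairing (snd x - partial_sum N (snd x)) (fst y) - pairing (fst x - partial_sum N (fst x)) (snd y))
      \<longlonglongrightarrow> 0 - 0"
    by (intro tendsto_diff pairing_remainder_tendsto_0)
  then show ?thesis
    by (simp add: Omega_pairing mode_projection_partial_sum pairing_commute[of "fst y"])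
qed

lemma beta_block_diagonal:
  assumes "block_diagonal A M" "M m = diag4 a b c d" "m \<ge> 1"
  shows "beta m (A x) = (a * fst (beta m x), b * snd (beta m x))"
proof -
  have B: "B m (A x) = diag4 a b c d *v B m x"
    using assms unfolding block_diagonal_def by metis
  have "(diag4 a b c d *v w) $ 1 = a * w $ 1" "(diag4 a b c d *v w) $ 2 = b * w $ 2" for w
    by (simp_all add: matrix_vector_mult_def diag4_def if_distrib[of "\<lambda>x. x * _"] vector_def
        cong: if_cong)
  from this[of "B m x"] show ?thesis
    unfolding B[symmetric] by (simp add: B_def vector_def beta_def)
qed

section \<open>Translation-invariant complex structures\<close>

text \<open>Makes the hypothesis stated with \<open>inv\<close> usable: the phases of
  \<open>T \<alpha>\<close> and \<open>T (- \<alpha>)\<close> cancel on every mode.\<close>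

lemma translation_bij:
  assumes T: "\<And>\<alpha>. block_diagonal (T \<alpha>) (translation_block \<alpha>)"
  shows "bij (T \<alpha>)"
proof -
  have beta_T: "beta m (T \<alpha> x) = (cis (real m * \<alpha>) * fst (beta m x), cis (real m * \<alpha>) * snd (beta m x))"
    if "m \<ge> 1" for m \<alpha> x
    using beta_block_diagonal[OF T translation_block_def that] .
  have "T \<alpha> (T (- \<alpha>) x) = x" for \<alpha> x
    by (rule phase_eqI) (simp add: beta_T mult.assoc[symmetric] cis_mult)
  from this[of \<alpha>] this[of "- \<alpha>"] show ?thesis
    by (intro o_bij[of "T (- \<alpha>)"]) (simp_all add: fun_eq_iff)
qed

lemma translation_invariant_commutes:
  assumes T: "\<And>\<alpha>. block_diagonal (T \<alpha>) (translation_block \<alpha>)"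
    and invariant: "\<And>\<alpha>. inv (T \<alpha>) \<circ> J \<circ> T \<alpha> = J"
  shows "J (T \<alpha> x) = T \<alpha> (J x)"
proof -
  have "J x = inv (T \<alpha>) (J (T \<alpha> x))"
    using fun_cong[OF invariant[of \<alpha>], of x] by simp
  then show ?thesis
    by (rule bij_inv_eq_iff[THEN iffD1, OF translation_bij[OF T], symmetric])
qed

text \<open>At pi / l the faster cosine reaches -1 while the slower one is at an angle below pi,
  where cosine is still larger. This is what separates the modes.\<close>

lemma cos_multiples_distinct:
  fixes m n :: nat
  assumes "\<And>\<alpha>. cos (real n * \<alpha>) = cos (real m * \<alpha>)"
  shows "n = m"
proof (rule ccontr)
  assume "n \<noteq> m"
  have less: False if "k < l" and eq: "\<And>\<alpha>. cos (real k * \<alpha>) = cos (real l * \<alpha>)" for k l :: nat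
  proof -
    have "cos (real k * (pi / real l)) = - 1"
      using that(1) eq[of "pi / real l"] by simp
    moreover have "real k * (pi / real l) < pi"
      using that(1) by (simp add: field_simps)
    ultimately show False
      using cos_monotone_0_pi[of "real k * (pi / real l)" pi] by simp
  qed
  from \<open>n \<noteq> m\<close> show False
    using less[OF _ assms] less[OF _ assms[symmetric]] by (rule linorder_neqE_nat)
qed

definition structure_block :: "real \<Rightarrow> complex \<Rightarrow> complex \<times> complex \<Rightarrow> complex \<times> complex" where
  "structure_block c q u = (\<i> * of_real c * fst u + q * snd u, cnj q * fst u - \<i> * of_real c * snd u)"

lemma compatible_antisym:
  assumes "compatible_complex_structure J"
  shows "Omega (J x) y = - Omega x (J y)"
proof -
  have "Omega (J x) (J (J y)) = Omega x (J y)" "J (J y) = - y"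
    using assms unfolding compatible_complex_structure_def symplectic_def by blast+
  then show ?thesis
    using linear_neg[OF Omega_linear_right, of "J x" y] by simp
qed

text \<open>The block is complex linear and antisymmetric for \<open>mode_form\<close>, which is
  twice the imaginary part of a Hermitian form of signature (1, 1). Hence its diagonal is imaginary
  and its off-diagonal entries are conjugate; squaring to -1 fixes the sizes and positivity the
  signs.\<close>

lemma compatible_invariant_block:
  assumes J: "compatible_complex_structure J"
    and T: "\<And>\<alpha>. block_diagonal (T \<alpha>) (translation_block \<alpha>)"
    and comm: "\<And>\<alpha> x. J (T \<alpha> x) = T \<alpha> (J x)"
    and m: "m \<ge> 1"
  obtains c q where "c > 0" "c\<^sup>2 = 1 + (cmod q)\<^sup>2"
    "\<And>x. beta m (J x) = structure_block c q (beta m x)"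
    "\<And>u. J (mode m u) = mode m (structure_block c q u)"
proof -
  have J_linear: "linear J" and JJ: "J (J x) = - x" and J_pos: "x \<noteq> 0 \<Longrightarrow> Omega (J x) x > 0" for x
    using J unfolding compatible_complex_structure_def by blast+
  have beta_T: "beta n (T \<alpha> x) = (cis (real n * \<alpha>) * fst (beta n x), cis (real n * \<alpha>) * snd (beta n x))"
    if "n \<ge> 1" for n \<alpha> x
    using beta_block_diagonal[OF T translation_block_def that] .
  have T_mode: "T \<alpha> (mode m u) = mode m (cis (real m * \<alpha>) * fst u, cis (real m * \<alpha>) * snd u)" for \<alpha> u
    by (rule phase_eqI) (auto simp: beta_T beta_mode[OF m] zero_prod_def)
  \<comment> \<open>On mode \<open>m\<close>, \<open>T\<^sub>\<alpha> + T\<^sub>-\<^sub>\<alpha>\<close> is multiplication by \<open>2 cos (m \<alpha>)\<close>, and \<open>J\<close> preserves this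
    common eigenspace.\<close>
  have other: "beta n (J (mode m u)) = 0" if "n \<ge> 1" "n \<noteq> m" for n u
  proof (rule ccontr)
    assume nz: "beta n (J (mode m u)) \<noteq> 0"
    have "cos (real n * \<alpha>) = cos (real m * \<alpha>)" for \<alpha>
    proof -
      have cis_sum: "cis a * z + cis (- a) * z = (2 * cos a) *\<^sub>R z" for a z
        by (simp add: complex_eq_iff)
      have "T \<alpha> (mode m u) + T (- \<alpha>) (mode m u) = (2 * cos (real m * \<alpha>)) *\<^sub>R mode m u"
        unfolding T_mode linear_add[OF linear_mode, symmetric] linear_scale[OF linear_mode, symmetric]
        by (rule arg_cong[where f = "mode m"]) (simp add: prod_eq_iff cis_sum)
      then have "beta n (J (T \<alpha> (mode m u) + T (- \<alpha>) (mode m u))) =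
          beta n (J ((2 * cos (real m * \<alpha>)) *\<^sub>R mode m u))"
        by (simp only:)
      then have "beta n (T \<alpha> (J (mode m u))) + beta n (T (- \<alpha>) (J (mode m u))) =
          (2 * cos (real m * \<alpha>)) *\<^sub>R beta n (J (mode m u))"
        by (simp only: linear_add[OF J_linear] linear_scale[OF J_linear] comm
            linear_add[OF linear_beta] linear_scale[OF linear_beta])
      then have "(2 * cos (real n * \<alpha>)) *\<^sub>R beta n (J (mode m u)) =
          (2 * cos (real m * \<alpha>)) *\<^sub>R beta n (J (mode m u))"
        unfolding beta_T[OF that(1)] by (simp add: prod_eq_iff cis_sum)
      then show ?thesis
        using nz by simp
    qed
    then show False
      using cos_multiples_distinct[of n m] that(2) by simp
  qed
  define j where "j u = beta m (J (mode m u))" for u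
  have J_mode: "J (mode m u) = mode m (j u)" for u
    by (rule phase_eqI) (use other in \<open>auto simp: beta_mode[OF m] j_def\<close>)
  have j_linear: "linear j"
    unfolding j_def using linear_compose[OF linear_compose[OF linear_mode J_linear] linear_beta]
    by (simp add: o_def)
  \<comment> \<open>A translation by a quarter period multiplies by \<open>i\<close>, so \<open>j\<close> is complex linear.\<close>
  have j_i: "j (\<i> * a, \<i> * b) = (\<i> * fst (j (a, b)), \<i> * snd (j (a, b)))" for a b
  proof -
    define \<alpha> where "\<alpha> = pi / (2 * real m)"
    have "real m * \<alpha> = pi / 2"
      using m by (simp add: \<alpha>_def)
    then have "cis (real m * \<alpha>) = \<i>"
      by (simp only: cis_pi_half)
    then show ?thesis
      unfolding j_def using T_mode[of \<alpha> "(a, b)"] comm[of \<alpha> "mode m (a, b)"] beta_T[OF m, of \<alpha>]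
      by simp
  qed
  obtain p r where j1: "j (1, 0) = (p, r)"
    by (rule prod.exhaust)
  obtain q t where j2: "j (0, 1) = (q, t)"
    by (rule prod.exhaust)
  have ji1: "j (\<i>, 0) = (\<i> * p, \<i> * r)" and ji2: "j (0, \<i>) = (\<i> * q, \<i> * t)"
    using j_i[of 1 0] j_i[of 0 1] j1 j2 by simp_all
  have j_eq: "j u = (p * fst u + q * snd u, r * fst u + t * snd u)" for u
  proof -
    have "u = Re (fst u) *\<^sub>R (1, 0) + Im (fst u) *\<^sub>R (\<i>, 0) + Re (snd u) *\<^sub>R (0, 1) + Im (snd u) *\<^sub>R (0, \<i>)"
      by (simp add: prod_eq_iff complex_eq_iff)
    then have "j u = j (Re (fst u) *\<^sub>R (1, 0) + Im (fst u) *\<^sub>R (\<i>, 0) + Re (snd u) *\<^sub>R (0, 1)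
        + Im (snd u) *\<^sub>R (0, \<i>))"
      by (rule arg_cong)
    also have "\<dots> = Re (fst u) *\<^sub>R (p, r) + Im (fst u) *\<^sub>R (\<i> * p, \<i> * r)
        + Re (snd u) *\<^sub>R (q, t) + Im (snd u) *\<^sub>R (\<i> * q, \<i> * t)"
      by (simp only: linear_add[OF j_linear] linear_scale[OF j_linear] j1 j2 ji1 ji2)
    finally show ?thesis
      by (simp add: prod_eq_iff complex_eq_iff algebra_simps)
  qed
  have form: "mode_form (j u) v = - mode_form u (j v)" for u v
    using compatible_antisym[OF J, of "mode m u" "mode m v"]
    by (simp add: J_mode Omega_mode[OF m] beta_mode[OF m m])
  have Re_p: "Re p = 0"
    using form[of "(1, 0)" "(\<i>, 0)"] by (simp add: mode_form_def j_eq)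
  have Re_t: "Re t = 0"
    using form[of "(0, 1)" "(0, \<i>)"] by (simp add: mode_form_def j_eq)
  have r: "r = cnj q"
    using form[of "(1, 0)" "(0, 1)"] form[of "(1, 0)" "(0, \<i>)"]
    by (simp add: mode_form_def j_eq complex_eq_iff)
  have pp: "p * p = of_real (- (Im p)\<^sup>2)" and tt: "t * t = of_real (- (Im t)\<^sup>2)"
    by (simp_all add: complex_eq_iff Re_p Re_t power2_eq_square)
  have jj: "j (j u) = - u" for u
  proof -
    have "mode m (j (j u)) = mode m (- u)"
      using JJ[of "mode m u"] by (simp add: J_mode linear_neg[OF linear_mode])
    then have "beta m (mode m (j (j u))) = beta m (mode m (- u))"
      by simp
    then show ?thesis
      by (simp add: beta_mode[OF m m])
  qed
  have norms: "q * cnj q = of_real ((cmod q)\<^sup>2)"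
    by (rule complex_norm_square[symmetric])
  have "p * p + q * r = -1"
    using jj[of "(1, 0)"] by (simp add: j_eq)
  then have "complex_of_real (- (Im p)\<^sup>2 + (cmod q)\<^sup>2) = of_real (- 1)"
    unfolding r norms pp by simp
  then have p2: "(Im p)\<^sup>2 = 1 + (cmod q)\<^sup>2"
    unfolding of_real_eq_iff by simp
  have "r * q + t * t = -1"
    using jj[of "(0, 1)"] by (simp add: j_eq)
  then have "complex_of_real (- (Im t)\<^sup>2 + (cmod q)\<^sup>2) = of_real (- 1)"
    unfolding r mult.commute[of "cnj q"] norms tt by simp
  then have t2: "(Im t)\<^sup>2 = 1 + (cmod q)\<^sup>2"
    unfolding of_real_eq_iff by simp
  have pos: "mode_form (j u) u > 0" if "u \<noteq> 0" for u
  proof -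
    have "mode m u \<noteq> 0"
    proof
      assume "mode m u = 0"
      then have "beta m (mode m u) = 0"
        by (simp only: linear_0[OF linear_beta])
      then show False
        using that by (simp add: beta_mode[OF m m])
    qed
    from J_pos[OF this] show ?thesis
      by (simp add: J_mode Omega_mode[OF m] beta_mode[OF m m])
  qed
  \<comment> \<open>The components enter \<open>mode_form\<close> with opposite signs, so positivity
    gives \<open>Im p\<close> and \<open>Im t\<close> opposite signs; as their squares agree,
    \<open>t\<close> is \<open>- p\<close>.\<close>
  have "Im p > 0"
    using pos[of "(1, 0)"] by (simp add: mode_form_def j_eq zero_prod_def)
  have "Im t < 0"
    using pos[of "(0, 1)"] by (simp add: mode_form_def j_eq zero_prod_def)
  have Im_t: "Im t = - Im p"
    using p2 t2 \<open>Im p > 0\<close> \<open>Im t < 0\<close> power2_eq_iff[of "Im t" "Im p"] by linarith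
  have j_block: "j = structure_block (Im p) q"
    by (rule ext) (simp add: structure_block_def j_eq r prod_eq_iff complex_eq_iff Re_p Re_t Im_t)
  \<comment> \<open>For a general \<open>x\<close> the coefficient of \<open>J x\<close> is
    determined by its pairings with all vectors of mode \<open>m\<close>, where \<open>J\<close> can
    be moved to the mode side.\<close>
  have beta_J: "beta m (J x) = j (beta m x)" for x
  proof (rule mode_form_nondegenerate)
    fix v
    have "mode_form v (beta m (J x)) = - Omega (J (mode m v)) x"
      by (simp add: Omega_mode[OF m, symmetric] compatible_antisym[OF J])
    also have "\<dots> = - mode_form (j v) (beta m x)"
      by (simp add: J_mode Omega_mode[OF m])
    also have "\<dots> = mode_form v (j (beta m x))"
      by (simp add: form)
    finally show "mode_form v (beta m (J x)) = mode_form v (j (beta m x))" .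
  qed
  show thesis
    by (rule that[OF \<open>Im p > 0\<close> p2 beta_J[unfolded j_block] J_mode[unfolded j_block]])
qed

section \<open>Implementability and equivalence\<close>

lemma linear_structure_block: "linear (structure_block c q)"
  by (rule linearI) (simp_all add: structure_block_def prod_eq_iff scaleR_conv_of_real algebra_simps)

text \<open>With \<open>z\<close> the evolution phase, \<open>v\<close> is the image of \<open>(1, 0)\<close> under the antilinear part
  \<open>(U + J U J) / 2\<close>; explicitly \<open>v = - Im z (i |q|\<^sup>2, c q\<^sup>*)\<close>.\<close>

lemma antilinear_block_norm:
  assumes c: "c\<^sup>2 = 1 + (cmod q)\<^sup>2"
    and v: "v = (1 / 2 :: real) *\<^sub>R ((z, 0) +
      structure_block c q (z * fst (structure_block c q (1, 0)), cnj z * snd (structure_block c q (1, 0))))"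
  shows "mode_form (structure_block c q v) v = 2 * c * ((Im z)\<^sup>2 * (cmod q)\<^sup>2)"
proof -
  define y where "y = complex_of_real (Im z)"
  have qq: "q * cnj q = of_real ((cmod q)\<^sup>2)"
    by (rule complex_norm_square[symmetric])
  have cc: "complex_of_real c * of_real c = 1 + q * cnj q"
  proof -
    have "complex_of_real c * of_real c = of_real (c\<^sup>2)"
      by (simp add: power2_eq_square)
    then show ?thesis
      unfolding c qq by simp
  qed
  have z: "z - cnj z = 2 * \<i> * y"
    by (simp add: y_def complex_eq_iff)
  have "2 * fst v = z - (of_real c * of_real c) * z + q * cnj q * cnj z"
    by (simp add: v structure_block_def scaleR_conv_of_real algebra_simps)
  also have "\<dots> = - (q * cnj q) * (z - cnj z)"
    unfolding cc by (simp add: algebra_simps)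
  finally have v1: "fst v = - (\<i> * y * (q * cnj q))"
    unfolding z by simp
  have "2 * snd v = \<i> * of_real c * cnj q * (z - cnj z)"
    by (simp add: v structure_block_def scaleR_conv_of_real algebra_simps)
  then have v2: "snd v = - (of_real c * y * cnj q)"
    unfolding z by (simp add: algebra_simps)
  have j1: "fst (structure_block c q v) = 0"
    by (simp add: structure_block_def v1 v2 algebra_simps)
  have "snd (structure_block c q v) = \<i> * y * cnj q * (of_real c * of_real c - q * cnj q)"
    by (simp add: structure_block_def v1 v2 algebra_simps)
  then have j2: "snd (structure_block c q v) = \<i> * y * cnj q"
    unfolding cc by simp
  have "mode_form (structure_block c q v) v = 2 * Im (\<i> * (of_real c * (y * cnj y) * (q * cnj q)))"
    unfolding mode_form_def j1 j2 v2 by (simp add: algebra_simps)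
  also have "\<dots> = 2 * c * ((Im z)\<^sup>2 * (cmod q)\<^sup>2)"
    unfolding qq y_def by (simp add: power2_eq_square)
  finally show ?thesis .
qed

lemma completion_inner:
  assumes "is_completion J \<iota>"
  shows "\<iota> x \<bullet> \<iota> y = Omega (J x) y / 2"
proof -
  have "\<iota> x \<bullet> \<iota> y = Re (inner_J J x y)"
    using assms unfolding is_completion_def by blast
  then show ?thesis
    by (simp add: inner_J_def)
qed

text \<open>One unit vector per mode already bounds the Hilbert-Schmidt sum from below; these
  vectors are orthogonal because \<open>J\<close> preserves each mode.\<close>

lemma implementable_sum_bound:
  fixes \<iota> :: "phase \<Rightarrow> 'h :: {real_inner, complete_space}"
  assumes completion: "is_completion J \<iota>" and J_linear: "linear J"
    and U: "block_diagonal U (evolution_block t t0)"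
    and c_pos: "\<And>m. m \<ge> 1 \<Longrightarrow> c m > 0"
    and c: "\<And>m. m \<ge> 1 \<Longrightarrow> (c m)\<^sup>2 = 1 + (cmod (q m))\<^sup>2"
    and J_mode: "\<And>m u. m \<ge> 1 \<Longrightarrow> J (mode m u) = mode m (structure_block (c m) (q m) u)"
    and implementable: "unitarily_implementable \<iota> J U"
  shows "summable (\<lambda>m. (sin (real m * (t - t0)))\<^sup>2 * (cmod (q m))\<^sup>2)"
proof -
  obtain S E where S: "bounded_linear S" "\<And>x. S (\<iota> x) = \<iota> (antilinear_part J U x)"
    and E: "orthonormal_basis E" "(\<lambda>e. (norm (S e))\<^sup>2) summable_on E"
    using implementable
    unfolding unitarily_implementable_def hilbert_schmidt_wrt_def hilbert_schmidt_def by blast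
  have \<iota>_linear: "linear \<iota>"
    using completion by (simp add: is_completion_def)
  have inner_mode: "\<iota> (mode m u) \<bullet> \<iota> (mode n v) =
      (if m = n then mode_form (structure_block (c m) (q m) u) v / 2 else 0)" if "m \<ge> 1" "n \<ge> 1" for m n u v
    using that by (simp add: completion_inner[OF completion] J_mode Omega_mode beta_mode mode_form_def)
  have U_mode: "U (mode m u) = mode m (cis (- (real m * (t - t0))) * fst u, cnj (cis (- (real m * (t - t0)))) * snd u)"
    if m: "m \<ge> 1" for m u
  proof (rule phase_eqI)
    fix n :: nat assume n: "n \<ge> 1"
    have "evolution_block t t0 n = diag4 (cis (- (real n * (t - t0)))) (cnj (cis (- (real n * (t - t0)))))
        (cis (- (real n * (t - t0)))) (cnj (cis (- (real n * (t - t0)))))"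
      by (simp add: evolution_block_def Let_def)
    from beta_block_diagonal[OF U this n] beta_mode[OF m n]
    show "beta n (U (mode m u)) =
        beta n (mode m (cis (- (real m * (t - t0))) * fst u, cnj (cis (- (real m * (t - t0)))) * snd u))"
      by (simp add: zero_prod_def)
  qed
  \<comment> \<open>The squared \<open>J\<close>-norm of this mode is \<open>c m\<close>. The same
    factor appears in the squared norm of its image and cancels, so no control of \<open>c\<close>
    is required.\<close>
  define f where "f m = (1 / sqrt (c m)) *\<^sub>R \<iota> (mode m (1, 0))" for m
  have f_norm: "norm (f m) = 1" if "m \<ge> 1" for m
    using c_pos[OF that]
    by (simp add: f_def norm_eq_sqrt_inner inner_mode[OF that that] mode_form_def structure_block_def)
  have f_orthogonal: "orthogonal (f m) (f n)" if "m \<ge> 1" "n \<ge> 1" "m \<noteq> n" for m n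
    using that by (simp add: f_def orthogonal_def inner_mode)
  have S_f: "(norm (S (f m)))\<^sup>2 = (sin (real m * (t - t0)))\<^sup>2 * (cmod (q m))\<^sup>2" if m: "m \<ge> 1" for m
  proof -
    let ?j = "structure_block (c m) (q m)" and ?z = "cis (- (real m * (t - t0)))"
    define v where "v = (1 / 2 :: real) *\<^sub>R ((?z, 0) + ?j (?z * fst (?j (1, 0)), cnj ?z * snd (?j (1, 0))))"
    have A: "antilinear_part J U (mode m (1, 0)) = mode m v"
      by (simp add: antilinear_part_def v_def U_mode[OF m] J_mode[OF m]
          linear_add[OF linear_mode] linear_scale[OF linear_mode])
    have "(norm (S (f m)))\<^sup>2 = (norm (\<iota> (mode m v)))\<^sup>2 / c m"
      using c_pos[OF m]
      by (simp add: f_def linear_scale[OF bounded_linear.linear[OF S(1)]] S(2) A power_divide)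
    also have "(norm (\<iota> (mode m v)))\<^sup>2 = mode_form (?j v) v / 2"
      by (simp add: power2_norm_eq_inner inner_mode[OF m m])
    also have "\<dots> = c m * ((Im ?z)\<^sup>2 * (cmod (q m))\<^sup>2)"
      using antilinear_block_norm[OF c[OF m] v_def] by simp
    finally show ?thesis
      using c_pos[OF m] by simp
  qed
  have "(\<Sum>m<n. (sin (real m * (t - t0)))\<^sup>2 * (cmod (q m))\<^sup>2) \<le> infsum (\<lambda>e. (norm (S e))\<^sup>2) E" for n
  proof -
    \<comment> \<open>Index 0 is no mode and \<open>q 0\<close> is arbitrary, but its weight sin 0
      vanishes.\<close>
    have "(\<Sum>m<n. (sin (real m * (t - t0)))\<^sup>2 * (cmod (q m))\<^sup>2) =
        (\<Sum>m\<in>{1..<n}. (sin (real m * (t - t0)))\<^sup>2 * (cmod (q m))\<^sup>2)"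
      by (rule sum.mono_neutral_right) (auto simp: not_le)
    also have "\<dots> = (\<Sum>m\<in>{1..<n}. (norm (S (f m)))\<^sup>2)"
      by (rule sum.cong) (simp_all add: S_f)
    also have "\<dots> \<le> infsum (\<lambda>e. (norm (S e))\<^sup>2) E"
      by (rule hilbert_schmidt_norm_basis_independent[OF E(1) S(1) E(2)])
        (auto simp: pairwise_def intro!: f_orthogonal f_norm)
    finally show ?thesis .
  qed
  then show ?thesis
    by (intro summableI_nonneg_bounded) simp_all
qed

section \<open>Modes in the reference representation and the extension of
  \<open>J - J0\<close>\<close>

locale reference_completion =
  fixes J0 :: "phase \<Rightarrow> phase" and \<iota>0 :: "phase \<Rightarrow> 'k :: {real_inner, complete_space}"
  assumes reference: "block_diagonal J0 reference_block"
    and completion: "is_completion J0 \<iota>0"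
begin

lemma linear_completion: "linear \<iota>0"
  using completion by (simp add: is_completion_def)

lemma beta_J0:
  assumes "m \<ge> 1"
  shows "beta m (J0 x) = (\<i> * fst (beta m x), - \<i> * snd (beta m x))"
  using beta_block_diagonal[OF reference reference_block_def assms] .

text \<open>Acting on the first argument, \<open>J0\<close> turns \<open>mode_form\<close> into
  twice the Euclidean product, and the 1/2 in \<open>inner_J\<close> cancels the 2; so every mode
  embeds isometrically.\<close>

lemma inner_mode:
  assumes m: "m \<ge> 1"
  shows "\<iota>0 (mode m u) \<bullet> \<iota>0 x = u \<bullet> beta m x"
proof -
  have "J0 (mode m u) = mode m (\<i> * fst u, - \<i> * snd u)"
    by (rule phase_eqI) (simp add: beta_J0 beta_mode[OF m] zero_prod_def)
  then show ?thesis
    by (simp add: completion_inner[OF completion] Omega_mode[OF m] mode_form_def inner_prod_def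
        inner_complex_def)
qed

text \<open>Weak convergence becomes norm convergence: the remainder is orthogonal to the
  projection, so its squared norm equals its product with the fixed vector
  \<open>\<iota>0 x\<close>.\<close>

lemma mode_projection_tendsto: "(\<lambda>N. \<iota>0 (mode_projection N x)) \<longlonglongrightarrow> \<iota>0 x"
proof -
  have inner: "\<iota>0 (x - mode_projection N x) \<bullet> \<iota>0 (x - mode_projection N x) =
      - Omega (x - mode_projection N x) (J0 x) / 2" for N
  proof -
    let ?r = "x - mode_projection N x"
    have beta_r: "beta m ?r = 0" if "m \<ge> 1" "m \<le> N" for m
    proof -
      have "beta m (mode_projection N x) = (\<Sum>n=1..N. if n = m then beta m x else 0)"
        unfolding mode_projection_def linear_sum[OF linear_beta]
        using that by (intro sum.cong) (auto simp: beta_mode)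
      then show ?thesis
        using that by (simp add: linear_diff[OF linear_beta])
    qed
    have "\<iota>0 (mode_projection N x) \<bullet> \<iota>0 ?r = 0"
      unfolding mode_projection_def linear_sum[OF linear_completion] inner_sum_left
      using beta_r unfolding mode_projection_def by (intro sum.neutral) (auto simp: inner_mode)
    then have "\<iota>0 ?r \<bullet> \<iota>0 ?r = \<iota>0 x \<bullet> \<iota>0 ?r"
      by (simp add: linear_diff[OF linear_completion] inner_diff_left)
    then show ?thesis
      using Omega_antisym[of "J0 x"] by (simp add: completion_inner[OF completion])
  qed
  have "(\<lambda>N. \<iota>0 (x - mode_projection N x) \<bullet> \<iota>0 (x - mode_projection N x)) \<longlonglongrightarrow> - 0 / 2"
    unfolding inner by (intro tendsto_divide tendsto_minus Omega_remainder_tendsto_0 tendsto_const) simp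
  from tendsto_real_sqrt[OF this] have "(\<lambda>N. norm (\<iota>0 (x - mode_projection N x))) \<longlonglongrightarrow> 0"
    by (simp add: norm_eq_sqrt_inner)
  then have "(\<lambda>N. \<iota>0 x - \<iota>0 (mode_projection N x)) \<longlonglongrightarrow> 0"
    unfolding linear_diff[OF linear_completion] by (rule tendsto_norm_zero_cancel)
  from tendsto_minus[OF this] have "(\<lambda>N. \<iota>0 (mode_projection N x) - \<iota>0 x) \<longlonglongrightarrow> 0"
    by simp
  then show ?thesis
    by (rule LIM_zero_cancel)
qed

text \<open>Blocks are indexed from 0 and modes from 1, hence \<open>Suc n\<close>. Density follows
  since every \<open>\<iota>0 x\<close> is a limit of finite sums of modes.\<close>

sublocale orthogonal_blocks "\<lambda>n u. \<iota>0 (mode (Suc n) u)"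
proof (rule orthogonal_blocks.intro)
  show "linear (\<lambda>u. \<iota>0 (mode (Suc n) u))" for n
    using linear_compose[OF linear_mode linear_completion] by (simp add: o_def)
  show "\<iota>0 (mode (Suc n) u) \<bullet> \<iota>0 (mode (Suc n) v) = u \<bullet> v" for n u v
    by (simp add: inner_mode beta_mode)
  show "\<iota>0 (mode (Suc m) u) \<bullet> \<iota>0 (mode (Suc n) v) = 0" if "m \<noteq> n" for m n u v
    using that by (simp add: inner_mode beta_mode)
  let ?M = "span (\<Union>n. range (\<lambda>u. \<iota>0 (mode (Suc n) u)))"
  have "\<iota>0 x \<in> closure ?M" for x
  proof -
    have "\<iota>0 (mode_projection N x) \<in> ?M" for N
      unfolding mode_projection_def linear_sum[OF linear_completion]
    proof (rule span_sum)
      fix m assume "m \<in> {1..N}"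
      then obtain n where "m = Suc n"
        by (cases m) auto
      then show "\<iota>0 (mode m (beta m x)) \<in> ?M"
        by (intro span_base) blast
    qed
    then show ?thesis
      unfolding closure_sequential using mode_projection_tendsto
      by (intro exI[of _ "\<lambda>N. \<iota>0 (mode_projection N x)"] conjI allI)
  qed
  then have "closure (range \<iota>0) \<subseteq> closure ?M"
    by (intro closure_minimal) auto
  then show "closure ?M = UNIV"
    using completion by (auto simp: is_completion_def)
qed

lemma coords_completion: "coords (\<lambda>u. \<iota>0 (mode (Suc n) u)) (\<iota>0 x) = beta (Suc n) x"
proof (rule euclidean_eqI)
  fix b :: "complex \<times> complex"
  have "coords (\<lambda>u. \<iota>0 (mode (Suc n) u)) (\<iota>0 x) \<bullet> b = \<iota>0 x \<bullet> \<iota>0 (mode (Suc n) b)"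
    by (rule coords_inner[OF linear_block])
  also have "\<dots> = \<iota>0 (mode (Suc n) b) \<bullet> \<iota>0 x"
    by (rule inner_commute)
  also have "\<dots> = b \<bullet> beta (Suc n) x"
    by (rule inner_mode) simp
  also have "\<dots> = beta (Suc n) x \<bullet> b"
    by (rule inner_commute)
  finally show "coords (\<lambda>u. \<iota>0 (mode (Suc n) u)) (\<iota>0 x) \<bullet> b = beta (Suc n) x \<bullet> b" .
qed

lemma fock_equivalentI:
  assumes c_pos: "\<And>m. m \<ge> 1 \<Longrightarrow> c m > 0"
    and c: "\<And>m. m \<ge> 1 \<Longrightarrow> (c m)\<^sup>2 = 1 + (cmod (q m))\<^sup>2"
    and beta_J: "\<And>m x. m \<ge> 1 \<Longrightarrow> beta m (J x) = structure_block (c m) (q m) (beta m x)"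
    and summable: "summable (\<lambda>m. (cmod (q m))\<^sup>2)"
  shows "fock_equivalent \<iota>0 J J0"
proof -
  define d where "d n u = structure_block (c (Suc n)) (q (Suc n)) u - (\<i> * fst u, - \<i> * snd u)" for n u
  have d_linear: "linear (d n)" for n
    unfolding d_def
    by (intro linear_compose_sub linear_structure_block)
      (auto intro!: linearI simp: algebra_simps scaleR_conv_of_real)
  \<comment> \<open>From c^2 = 1 + |q|^2 and c > 0 one gets 0 <= c - 1 <= |q|. Each of the four
    entries of the block is then at most |q| in modulus, whence the factor 4.\<close>
  have d_bound: "norm (d n u) \<le> 4 * cmod (q (Suc n)) * norm u" for n u
  proof -
    let ?c = "c (Suc n)" and ?q = "q (Suc n)"
    have "?c\<^sup>2 \<le> (1 + cmod ?q)\<^sup>2"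
      using c[of "Suc n"] by (simp add: power2_sum)
    then have "?c \<le> 1 + cmod ?q"
      by (rule power2_le_imp_le) simp
    moreover have "1\<^sup>2 \<le> ?c\<^sup>2"
      using c[of "Suc n"] by simp
    then have "1 \<le> ?c"
      using c_pos[of "Suc n"] by (intro power2_le_imp_le[of 1 ?c]) auto
    ultimately have "cmod (of_real (?c - 1)) \<le> cmod ?q"
      unfolding norm_of_real by simp
    then have diag: "cmod (\<i> * of_real (?c - 1) * w) \<le> cmod ?q * norm u" if "cmod w \<le> norm u" for w
      using that unfolding norm_mult by (intro mult_mono) auto
    have off: "cmod (w' * w) \<le> cmod ?q * norm u" if "cmod w \<le> norm u" "cmod w' = cmod ?q" for w w'
      using that by (simp add: norm_mult mult_left_mono)
    have u: "cmod (fst u) \<le> norm u" "cmod (snd u) \<le> norm u"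
      by (metis norm_fst_le prod.collapse) (metis norm_snd_le prod.collapse)
    have "d n u = (\<i> * of_real (?c - 1) * fst u + ?q * snd u, cnj ?q * fst u - \<i> * of_real (?c - 1) * snd u)"
      by (simp add: d_def structure_block_def algebra_simps)
    then have "norm (d n u) \<le> cmod (\<i> * of_real (?c - 1) * fst u + ?q * snd u)
        + cmod (cnj ?q * fst u - \<i> * of_real (?c - 1) * snd u)"
      by (simp only: norm_Pair_le)
    also have "\<dots> \<le> (cmod (\<i> * of_real (?c - 1) * fst u) + cmod (?q * snd u))
        + (cmod (cnj ?q * fst u) + cmod (\<i> * of_real (?c - 1) * snd u))"
      by (intro add_mono norm_triangle_ineq norm_triangle_ineq4)
    also have "\<dots> \<le> (cmod ?q * norm u + cmod ?q * norm u) + (cmod ?q * norm u + cmod ?q * norm u)"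
      by (intro add_mono diag off u) auto
    finally show ?thesis
      by (simp add: mult_ac)
  qed
  have "summable (\<lambda>n. 16 * (cmod (q (Suc n)))\<^sup>2)"
    using summable summable_Suc_iff[of "\<lambda>m. (cmod (q m))\<^sup>2"] by (intro summable_mult) blast
  then have "summable (\<lambda>n. (4 * cmod (q (Suc n)))\<^sup>2)"
    by (simp add: power_mult_distrib)
  then obtain S where S: "hilbert_schmidt S"
    "\<And>n v. coords (\<lambda>u. \<iota>0 (mode (Suc n) u)) (S v) = d n (coords (\<lambda>u. \<iota>0 (mode (Suc n) u)) v)"
    by (rule block_hilbert_schmidt[OF d_linear d_bound, rotated]) simp_all
  \<comment> \<open>Equal coordinates in every mode suffice, so \<open>S\<close> extends
    \<open>J - J0\<close> without any limit being taken through \<open>J\<close>.\<close>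
  have "S (\<iota>0 x) = \<iota>0 (J x - J0 x)" for x
  proof (rule eq_of_coords_eq)
    show "coords (\<lambda>u. \<iota>0 (mode (Suc n) u)) (S (\<iota>0 x)) =
        coords (\<lambda>u. \<iota>0 (mode (Suc n) u)) (\<iota>0 (J x - J0 x))" for n
      by (simp add: S(2) coords_completion linear_diff[OF linear_beta] beta_J beta_J0 d_def)
  qed
  then show ?thesis
    unfolding fock_equivalent_def hilbert_schmidt_wrt_def using S(1) by blast
qed

end

theorem mainTheorem3:
  fixes T :: "real \<Rightarrow> phase \<Rightarrow> phase"
    and U :: "real \<Rightarrow> real \<Rightarrow> phase \<Rightarrow> phase"
    and J0 J :: "phase \<Rightarrow> phase"
    and \<iota> :: "phase \<Rightarrow> 'h :: {real_inner, complete_space}"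
    and \<iota>0 :: "phase \<Rightarrow> 'k :: {real_inner, complete_space}"
  assumes translation: "\<And>\<alpha>. block_diagonal (T \<alpha>) (translation_block \<alpha>)"
    and evolution: "\<And>t t0. t > 0 \<Longrightarrow> t0 > 0 \<Longrightarrow> block_diagonal (U t t0) (evolution_block t t0)"
    and reference: "block_diagonal J0 reference_block"
    and completion_J0: "is_completion J0 \<iota>0"
    and compatible: "compatible_complex_structure J"
    and completion_J: "is_completion J \<iota>"
    and invariant: "\<And>\<alpha>. inv (T \<alpha>) \<circ> J \<circ> T \<alpha> = J"
    and implementable: "\<And>t t0. t > 0 \<Longrightarrow> t0 > 0 \<Longrightarrow> unitarily_implementable \<iota> J (U t t0)"
  shows "fock_equivalent \<iota>0 J J0"
proof -
  interpret reference_completion J0 \<iota>0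
    using reference completion_J0 by unfold_locales
  have comm: "J (T \<alpha> x) = T \<alpha> (J x)" for \<alpha> x
    by (rule translation_invariant_commutes[OF translation invariant])
  \<comment> \<open>Packing c and q into one pair, with the premise \<open>m \<ge> 1\<close> inside,
    allows a single choice over all \<open>m\<close>.\<close>
  define admissible where "admissible m cq \<longleftrightarrow> (m \<ge> 1 \<longrightarrow>
      fst cq > 0 \<and> (fst cq)\<^sup>2 = 1 + (cmod (snd cq))\<^sup>2 \<and>
      (\<forall>x. beta m (J x) = structure_block (fst cq) (snd cq) (beta m x)) \<and>
      (\<forall>u. J (mode m u) = mode m (structure_block (fst cq) (snd cq) u)))" for m cq
  have "\<exists>cq. admissible m cq" for m
  proof (cases "m \<ge> 1")
    case True
    obtain c q where "c > 0" "c\<^sup>2 = 1 + (cmod q)\<^sup>2"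
      "\<And>x. beta m (J x) = structure_block c q (beta m x)"
      "\<And>u. J (mode m u) = mode m (structure_block c q u)"
      by (rule compatible_invariant_block[OF compatible translation comm True]) (rule that)
    then have "admissible m (c, q)"
      unfolding admissible_def fst_conv snd_conv by blast
    then show ?thesis
      by blast
  qed (simp add: admissible_def)
  then obtain cq where cq: "\<And>m. admissible m (cq m)"
    using choice[of admissible] by blast
  define c q where "c = (\<lambda>m. fst (cq m))" and "q = (\<lambda>m. snd (cq m))"
  have c_pos: "c m > 0" and c: "(c m)\<^sup>2 = 1 + (cmod (q m))\<^sup>2"
    and beta_J: "beta m (J x) = structure_block (c m) (q m) (beta m x)"
    and J_mode: "J (mode m u) = mode m (structure_block (c m) (q m) u)" if "m \<ge> 1" for m x u
    using cq[of m] that unfolding admissible_def c_def q_def by blast+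
  have "summable (\<lambda>m. (sin (real m * \<tau>))\<^sup>2 * (cmod (q m))\<^sup>2)" for \<tau>
  proof -
    \<comment> \<open>The evolution is available for positive times only; these two are positive and
      differ by an arbitrary real \<open>\<tau>\<close>, as the Baire argument on the whole line
      demands.\<close>
    have pos: "\<bar>\<tau>\<bar> + 1 + \<tau> > 0" "\<bar>\<tau>\<bar> + 1 > 0"
      by linarith+
    have "linear J"
      using compatible unfolding compatible_complex_structure_def by blast
    from implementable_sum_bound[where c = c and q = q, OF completion_J this evolution[OF pos] c_pos c J_mode
        implementable[OF pos]]
    show ?thesis
      by simp
  qed
  then have "summable (\<lambda>m. (cmod (q m))\<^sup>2)"
    by (rule summable_of_summable_sin_sq[rotated]) simp
  with c_pos c beta_J show ?thesis
    by (rule fock_equivalentI[where c = c and q = q])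
qed

end
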